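(* Let $d\ge1$. For all $\mu,\tilde\mu,\nu,\tilde\nu\in\mathcal P_2(\mathbb R^d)$ such that $\mu\le_{cx}\nu$, $$\mathcal W_2\big(\mu,\mathcal I_2(\tilde\mu,\tilde\nu)\big)\le\overline{\mathcal W}_2(\mu,\tilde\mu)+\mathcal W_2(\nu,\tilde\nu).$$
   Context: $\mathcal P_2(\mathbb R^d)$ is the set of probability measures on $\mathbb R^d$ with finite second moment and $\mathcal W_2$ is the quadratic Wasserstein distance. For $\eta\in\mathcal P_2(\mathbb R^d)$, $m(\eta)=\int x\,\eta(dx)$. The centered Wasserstein distance is $\overline{\mathcal W}_2(\mu,\nu)=\left(\mathcal W_2^2(\mu,\nu)-|m(\mu)-m(\nu)|^2\right)^{1/2}$. The convex order is defined by $\mu\le_{cx}\nu$ iff $\int f\,d\mu\le\int f\,d\nu$ for every convex $f:\mathbb R^d\to\mathbb R$. $\mathcal I_2(\mu,\nu)$ denotes the (existing and unique) minimizer of $\eta\mapsto\mathcal W_2(\mu,\eta)$ over $\{\eta\in\mathcal P_2(\mathbb R^d):\eta\le_{cx}\nu\}$. *)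

theory Defs
  imports "HOL-Probability.Probability"
begin

definition P2 :: "'a::euclidean_space measure set" where
  "P2 = {M. prob_space M \<and> sets M = sets borel \<and> integrable M (\<lambda>x. (norm x)\<^sup>2)}"

definition couplings ::
    "'a::euclidean_space measure \<Rightarrow> 'a measure \<Rightarrow> ('a \<times> 'a) measure set" where
  "couplings \<mu> \<nu> =
     {\<pi>. prob_space \<pi> \<and> sets \<pi> = sets (borel \<Otimes>\<^sub>M borel) \<and>
         distr \<pi> borel fst = \<mu> \<and> distr \<pi> borel snd = \<nu>}"

(* The infimum is taken in the extended nonnegative reals; for arguments in P2 it is finite,
   so that enn2real loses no information there. *)
definition W2 :: "'a::euclidean_space measure \<Rightarrow> 'a measure \<Rightarrow> real" where
  "W2 \<mu> \<nu> =
     sqrt (enn2real (INF \<pi>\<in>couplings \<mu> \<nu>. \<integral>\<^sup>+ (x, y). ennreal ((norm (x - y))\<^sup>2) \<partial>\<pi>))"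

definition mean :: "'a::euclidean_space measure \<Rightarrow> 'a" where
  "mean \<eta> = (\<integral>x. x \<partial>\<eta>)"

definition centered_W2 :: "'a::euclidean_space measure \<Rightarrow> 'a measure \<Rightarrow> real" where
  "centered_W2 \<mu> \<nu> = sqrt ((W2 \<mu> \<nu>)\<^sup>2 - (norm (mean \<mu> - mean \<nu>))\<^sup>2)"

(* A convex function need not be integrable with respect to a measure in P2: its integral may be
   infinite (but never minus infinity, because of an affine minorant), whereas the Bochner integral
   would then be 0 by convention.  Hence the integral is taken as the difference of the integrals
   of the positive and the negative part, with values in the extended reals. *)
definition ext_integral :: "'a measure \<Rightarrow> ('a \<Rightarrow> real) \<Rightarrow> ereal" where
  "ext_integral M f =
     enn2ereal (\<integral>\<^sup>+ x. ennreal (f x) \<partial>M) - enn2ereal (\<integral>\<^sup>+ x. ennreal (- f x) \<partial>M)"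

definition convex_order :: "'a::euclidean_space measure \<Rightarrow> 'a measure \<Rightarrow> bool"
    (infix "\<le>\<^sub>c\<^sub>x" 50) where
  "\<mu> \<le>\<^sub>c\<^sub>x \<nu> \<longleftrightarrow>
     (\<forall>f :: 'a \<Rightarrow> real. convex_on UNIV f \<longrightarrow> ext_integral \<mu> f \<le> ext_integral \<nu> f)"

definition I2 :: "'a::euclidean_space measure \<Rightarrow> 'a measure \<Rightarrow> 'a measure" where
  "I2 \<mu> \<nu> = (THE \<eta>. is_arg_min (W2 \<mu>) (\<lambda>\<eta>. \<eta> \<in> P2 \<and> \<eta> \<le>\<^sub>c\<^sub>x \<nu>) \<eta>)"

end

(* Averaging a coupling over cells keeps its second marginal below nu' in convex order and brings
   it closer to mu, so by a Hilbert space argument in L^2(mu) the projection of mu is the law of a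
   map T; let T' be the map for mu'.  The set of laws below nu' is
   convex along every interpolation of random variables, which gives the obtuse angle condition on
   an arbitrary coupling of mu and mu', hence |T X - T' X'| is at most |X - X'| in L^2, and even
   after subtracting the difference of the means, since T X and T' X' have the same mean.
   It remains to bound |X - T X| by W2 nu nu'.  After averaging over cells, this is a duality for
   finite barycentric transport: there are maxima h and phi of affine functions with
   h x - phi y <= |x - y|^2 / 2 and with equality on average along the optimal plan; since h is
   convex, its integral against mu is at most its integral against nu, and any coupling of nu
   and nu' gives the bound. *)
theory Submission imports Defs begin

subsection \<open>Square-integrable random vectors\<close>

text \<open>Neither optimal couplings nor disintegrations are constructed. Estimates of
  \<open>W2\<close> from above come from random vectors on one probability space, those from below
  from couplings that are optimal up to some e > 0, with e sent to 0 at the end of each argument.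
  Averages over the finitely many cells of a simple function play the part of conditional
  expectations. Both projections, of \<mu> and of \<mu>', are onto the laws below \<nu>'; the
  theorem is then the triangle inequality |X - T' X'| <= |X - T X| + |T X - T' X'| in L^2 of a
  coupling of \<mu> and \<mu>'. Since \<open>I2\<close> is a definite description, existence of the
  minimizer is not enough: uniqueness has to be shown against every minimizer, not only against laws
  of maps. In the duality the factor 1/2 makes the cost its own convex conjugate: |z|^2 / 2 is the
  supremum of u . z - |u|^2 / 2 over u.\<close>

definition sq_integrable :: "'b measure \<Rightarrow> ('b \<Rightarrow> 'a::euclidean_space) \<Rightarrow> bool" where
  "sq_integrable M X \<longleftrightarrow> X \<in> borel_measurable M \<and> integrable M (\<lambda>w. (norm (X w))\<^sup>2)"

text \<open>Outside square-integrable arguments the Bochner integral defaults to 0, so a bound on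
  \<open>L2_norm\<close> carries information only together with
  \<open>sq_integrable\<close>.\<close>

definition L2_norm :: "'b measure \<Rightarrow> ('b \<Rightarrow> 'a::euclidean_space) \<Rightarrow> real" where
  "L2_norm M X = sqrt (\<integral>w. (norm (X w))\<^sup>2 \<partial>M)"

lemma L2_norm_nonneg: "0 \<le> L2_norm M X"
  by (simp add: L2_norm_def)

lemma L2_norm_power2: "(L2_norm M X)\<^sup>2 = (\<integral>w. (norm (X w))\<^sup>2 \<partial>M)"
  by (simp add: L2_norm_def)

lemma sq_integrable_measurable: "sq_integrable M X \<Longrightarrow> X \<in> borel_measurable M"
  by (simp add: sq_integrable_def)

lemma sq_integrable_inner:
  fixes X Y :: "'b \<Rightarrow> 'a::euclidean_space"
  assumes "sq_integrable M X" "sq_integrable M Y"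
  shows "integrable M (\<lambda>w. X w \<bullet> Y w)"
proof -
  have [measurable]: "X \<in> borel_measurable M" "Y \<in> borel_measurable M"
    using assms by (auto simp: sq_integrable_def)
  have le: "\<bar>x \<bullet> y\<bar> \<le> (norm x)\<^sup>2 + (norm y)\<^sup>2" for x y :: 'a
  proof -
    have "\<bar>x \<bullet> y\<bar> \<le> norm x * norm y" by (rule Cauchy_Schwarz_ineq2)
    also have "\<dots> \<le> (norm x)\<^sup>2 + (norm y)\<^sup>2"
      using sum_squares_bound[of "norm x" "norm y"] mult_nonneg_nonneg[OF norm_ge_zero norm_ge_zero, of x y]
      by linarith
    finally show ?thesis .
  qed
  show ?thesis
    by (rule Bochner_Integration.integrable_bound[where f="\<lambda>w. (norm (X w))\<^sup>2 + (norm (Y w))\<^sup>2"])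
       (use assms le in \<open>auto simp: sq_integrable_def\<close>)
qed

lemma sq_integrable_add:
  assumes "sq_integrable M X" "sq_integrable M Y"
  shows "sq_integrable M (\<lambda>w. X w + Y w)"
proof -
  have "integrable M (\<lambda>w. (norm (X w))\<^sup>2 + 2 * (X w \<bullet> Y w) + (norm (Y w))\<^sup>2)"
    using assms sq_integrable_inner[OF assms] by (auto simp: sq_integrable_def)
  then show ?thesis
    using assms by (auto simp: sq_integrable_def power2_norm_eq_inner algebra_simps inner_commute)
qed

lemma sq_integrable_scaleR:
  "sq_integrable M X \<Longrightarrow> sq_integrable M (\<lambda>w. c *\<^sub>R X w)"
  by (auto simp: sq_integrable_def power_mult_distrib)

lemma sq_integrable_diff:
  assumes "sq_integrable M X" "sq_integrable M Y"
  shows "sq_integrable M (\<lambda>w. X w - Y w)"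
  using sq_integrable_add[OF assms(1) sq_integrable_scaleR[OF assms(2), of "-1"]] by simp

lemma (in finite_measure) sq_integrable_const: "sq_integrable M (\<lambda>w. c)"
  by (auto simp: sq_integrable_def)

lemma (in finite_measure) sq_integrable_simple:
  assumes "simple_function M X"
  shows "sq_integrable M X"
proof -
  have "simple_function M (\<lambda>w. (norm (X w))\<^sup>2)"
    using simple_function_compose1[OF assms, of "\<lambda>x. (norm x)\<^sup>2"] by simp
  then show ?thesis
    using assms unfolding sq_integrable_def
    by (auto intro!: borel_measurable_simple_function integrable_simple_function)
qed

lemma (in finite_measure) sq_integrable_integrable:
  assumes "sq_integrable M X"
  shows "integrable M X"
proof (rule Bochner_Integration.integrable_bound[where f="\<lambda>w. (norm (X w))\<^sup>2 + 1"])
  have "norm x \<le> (norm x)\<^sup>2 + 1" for x :: 'b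
    using sum_squares_bound[of "norm x" 1] norm_ge_zero[of x]
    unfolding one_power2 mult_1_right by linarith
  then show "AE w in M. norm (X w) \<le> norm ((norm (X w))\<^sup>2 + 1)" by auto
qed (use assms in \<open>auto simp: sq_integrable_def\<close>)

text \<open>Cauchy-Schwarz from the nonnegativity of the integral of |s X - t Y|^2. The usual
  weights s = |Y| and t = |X| may vanish and then cannot be cancelled; they are raised by e > 0, and
  e tends to 0.\<close>

lemma L2_inner_le:
  assumes X: "sq_integrable M X" and Y: "sq_integrable M Y"
  shows "(\<integral>w. X w \<bullet> Y w \<partial>M) \<le> L2_norm M X * L2_norm M Y"
proof -
  define a b where "a = L2_norm M X" and "b = L2_norm M Y"
  let ?B = "\<integral>w. X w \<bullet> Y w \<partial>M"
  have a: "a\<^sup>2 = (\<integral>w. (norm (X w))\<^sup>2 \<partial>M)" and b: "b\<^sup>2 = (\<integral>w. (norm (Y w))\<^sup>2 \<partial>M)"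
    by (simp_all add: a_def b_def L2_norm_power2)
  have ab: "0 \<le> a" "0 \<le> b" by (simp_all add: a_def b_def L2_norm_nonneg)
  have *: "2 * s * t * ?B \<le> s\<^sup>2 * a\<^sup>2 + t\<^sup>2 * b\<^sup>2" for s t
  proof -
    have "0 \<le> (\<integral>w. (norm (s *\<^sub>R X w - t *\<^sub>R Y w))\<^sup>2 \<partial>M)" by simp
    also have "\<dots> = (\<integral>w. s\<^sup>2 * (norm (X w))\<^sup>2 + t\<^sup>2 * (norm (Y w))\<^sup>2 - 2 * s * t * (X w \<bullet> Y w) \<partial>M)"
      by (intro Bochner_Integration.integral_cong refl)
         (simp add: power2_norm_eq_inner power2_eq_square[of s] power2_eq_square[of t]
           inner_diff_left inner_diff_right inner_commute algebra_simps)
    also have "\<dots> = s\<^sup>2 * a\<^sup>2 + t\<^sup>2 * b\<^sup>2 - 2 * s * t * ?B"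
      using X Y sq_integrable_inner[OF X Y] by (simp add: a b sq_integrable_def)
    finally show ?thesis by simp
  qed
  have "?B \<le> (a + e) * (b + e)" if "e > 0" for e
  proof -
    have "2 * ((a + e) * (b + e)) * ?B = 2 * (b + e) * (a + e) * ?B" by simp
    also have "\<dots> \<le> (b + e)\<^sup>2 * a\<^sup>2 + (a + e)\<^sup>2 * b\<^sup>2" by (rule *)
    also have "\<dots> \<le> (b + e)\<^sup>2 * (a + e)\<^sup>2 + (a + e)\<^sup>2 * (b + e)\<^sup>2"
      using that ab by (intro add_mono mult_left_mono power_mono) auto
    also have "\<dots> = 2 * ((a + e) * (b + e)) * ((a + e) * (b + e))"
      by (simp add: power2_eq_square algebra_simps)
    finally show ?thesis using that ab by (subst (asm) mult_le_cancel_left_pos) auto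
  qed
  then have "\<forall>\<^sub>F e in at_right 0. ?B \<le> (a + e) * (b + e)"
    by (auto simp: eventually_at_filter)
  moreover have "((\<lambda>e. (a + e) * (b + e)) \<longlongrightarrow> (a + 0) * (b + 0)) (at_right 0)"
    by (intro tendsto_intros)
  ultimately have "?B \<le> (a + 0) * (b + 0)"
    by (intro tendsto_lowerbound) auto
  then show ?thesis by (simp add: a_def b_def)
qed

lemma L2_norm_add_le:
  assumes X: "sq_integrable M X" and Y: "sq_integrable M Y"
  shows "L2_norm M (\<lambda>w. X w + Y w) \<le> L2_norm M X + L2_norm M Y"
proof (rule power2_le_imp_le)
  have "(L2_norm M (\<lambda>w. X w + Y w))\<^sup>2
      = (\<integral>w. (norm (X w))\<^sup>2 + 2 * (X w \<bullet> Y w) + (norm (Y w))\<^sup>2 \<partial>M)"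
    unfolding L2_norm_power2
    by (intro Bochner_Integration.integral_cong refl)
       (simp add: power2_norm_eq_inner algebra_simps inner_commute)
  also have "\<dots> = (L2_norm M X)\<^sup>2 + 2 * (\<integral>w. X w \<bullet> Y w \<partial>M) + (L2_norm M Y)\<^sup>2"
    using X Y sq_integrable_inner[OF X Y] by (simp add: L2_norm_power2 sq_integrable_def)
  also have "\<dots> \<le> (L2_norm M X + L2_norm M Y)\<^sup>2"
    using L2_inner_le[OF X Y] by (simp add: power2_eq_square algebra_simps)
  finally show "(L2_norm M (\<lambda>w. X w + Y w))\<^sup>2 \<le> (L2_norm M X + L2_norm M Y)\<^sup>2" .
qed (simp add: L2_norm_nonneg)

lemma L2_norm_triangle:
  assumes "sq_integrable M X" "sq_integrable M Y" "sq_integrable M Z"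
  shows "L2_norm M (\<lambda>w. X w - Z w) \<le> L2_norm M (\<lambda>w. X w - Y w) + L2_norm M (\<lambda>w. Y w - Z w)"
  using L2_norm_add_le[OF sq_integrable_diff[OF assms(1,2)] sq_integrable_diff[OF assms(2,3)]]
  by simp

lemma (in prob_space) expectation_norm_le_L2_norm:
  assumes X: "sq_integrable M X"
  shows "(\<integral>w. norm (X w) \<partial>M) \<le> L2_norm M X"
proof -
  have N: "sq_integrable M (\<lambda>w. norm (X w))"
    using X by (auto simp: sq_integrable_def)
  have "(\<integral>w. norm (X w) \<bullet> (1::real) \<partial>M) \<le> L2_norm M (\<lambda>w. norm (X w)) * L2_norm M (\<lambda>w. 1::real)"
    by (intro L2_inner_le N sq_integrable_const)
  then show ?thesis by (simp add: L2_norm_def prob_space)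
qed

lemma sq_integrable_distr:
  assumes [measurable]: "T \<in> M \<rightarrow>\<^sub>M N" "X \<in> borel_measurable N"
  shows "sq_integrable (distr M N T) X \<longleftrightarrow> sq_integrable M (\<lambda>w. X (T w))"
  by (simp add: sq_integrable_def integrable_distr_eq)

lemma L2_norm_distr:
  assumes [measurable]: "T \<in> M \<rightarrow>\<^sub>M N" "X \<in> borel_measurable N"
  shows "L2_norm (distr M N T) X = L2_norm M (\<lambda>w. X (T w))"
  by (simp add: L2_norm_def integral_distr)

text \<open>Pointwise approximants bounded by 2 |X| differ from X by at most 3 |X|, so 9 |X|^2
  dominates the squared error.\<close>

lemma simple_function_L2_dense:
  assumes X: "sq_integrable M X" and e: "e > 0"
  obtains s where "simple_function M s" "sq_integrable M s" "L2_norm M (\<lambda>w. X w - s w) < e"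
proof -
  have [measurable]: "X \<in> borel_measurable M" using X by (simp add: sq_integrable_def)
  obtain s where s: "\<And>i. simple_function M (s i)"
      "\<And>w. w \<in> space M \<Longrightarrow> (\<lambda>i. s i w) \<longlonglongrightarrow> X w"
      "\<And>i w. w \<in> space M \<Longrightarrow> dist (s i w) 0 \<le> 2 * dist (X w) 0"
    using borel_measurable_implies_sequence_metric[OF \<open>X \<in> borel_measurable M\<close>, of 0] by blast
  have [measurable]: "s i \<in> borel_measurable M" for i
    using s(1) by (rule borel_measurable_simple_function)
  have bound: "norm (s i w) \<le> 2 * norm (X w)" if "w \<in> space M" for i w
    using s(3)[OF that, of i] by simp
  have sq: "sq_integrable M (s i)" for i
    unfolding sq_integrable_def
  proof
    show "integrable M (\<lambda>w. (norm (s i w))\<^sup>2)"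
    proof (rule Bochner_Integration.integrable_bound[where f="\<lambda>w. 4 * (norm (X w))\<^sup>2"])
      show "AE w in M. norm ((norm (s i w))\<^sup>2) \<le> norm (4 * (norm (X w))\<^sup>2)"
      proof (rule AE_I2)
        fix w assume "w \<in> space M"
        from power_mono[OF bound[OF this, of i], of 2]
        show "norm ((norm (s i w))\<^sup>2) \<le> norm (4 * (norm (X w))\<^sup>2)"
          by (simp add: power_mult_distrib)
      qed
    qed (use X in \<open>auto simp: sq_integrable_def\<close>)
  qed simp
  have "(\<lambda>i. \<integral>w. (norm (X w - s i w))\<^sup>2 \<partial>M) \<longlonglongrightarrow> (\<integral>w. 0 \<partial>M)"
  proof (rule integral_dominated_convergence[where w="\<lambda>w. 9 * (norm (X w))\<^sup>2"])
    show "AE w in M. (\<lambda>i. (norm (X w - s i w))\<^sup>2) \<longlonglongrightarrow> 0"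
    proof (rule AE_I2)
      fix w assume "w \<in> space M"
      have "(\<lambda>i. (norm (X w - s i w))\<^sup>2) \<longlonglongrightarrow> (norm (X w - X w))\<^sup>2"
        by (intro tendsto_intros s(2) \<open>w \<in> space M\<close>)
      then show "(\<lambda>i. (norm (X w - s i w))\<^sup>2) \<longlonglongrightarrow> 0" by simp
    qed
    show "AE w in M. norm ((norm (X w - s i w))\<^sup>2) \<le> 9 * (norm (X w))\<^sup>2" for i
    proof (rule AE_I2)
      fix w assume w: "w \<in> space M"
      have "norm (X w - s i w) \<le> 3 * norm (X w)"
        using norm_triangle_ineq4[of "X w" "s i w"] bound[OF w, of i] by simp
      from power_mono[OF this, of 2] show "norm ((norm (X w - s i w))\<^sup>2) \<le> 9 * (norm (X w))\<^sup>2"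
        by (simp add: power_mult_distrib)
    qed
  qed (use X in \<open>auto simp: sq_integrable_def\<close>)
  then have "(\<lambda>i. L2_norm M (\<lambda>w. X w - s i w)) \<longlonglongrightarrow> sqrt 0"
    unfolding L2_norm_def by (intro tendsto_intros) simp
  then have "\<forall>\<^sub>F i in sequentially. L2_norm M (\<lambda>w. X w - s i w) < e"
    using e by (intro order_tendstoD(2)[where y="sqrt 0"]) auto
  then obtain i where "L2_norm M (\<lambda>w. X w - s i w) < e"
    by (auto simp: eventually_sequentially)
  with s(1) sq that show ?thesis by blast
qed

subsection \<open>Convex functions and the convex order\<close>

text \<open>A hyperplane separates the open vertical ray below the graph at \<open>b\<close> from
  the epigraph. As \<open>f\<close> is finite everywhere, it cannot be vertical, and dividing by its
  last coefficient gives the slope.\<close>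

lemma convex_on_subgradient:
  fixes f :: "'a::euclidean_space \<Rightarrow> real"
  assumes f: "convex_on UNIV f"
  obtains a where "\<And>x. f b + a \<bullet> (x - b) \<le> f x"
proof -
  let ?S = "{b} \<times> {..<f b}"
  have "convex ?S" by (intro convex_Times) auto
  moreover have "convex (epigraph UNIV f)" using f by (rule convex_epigraphI)
  moreover have "?S \<noteq> {}" by (auto intro: exI[of _ "f b - 1"])
  moreover have "epigraph UNIV f \<noteq> {}" by (auto simp: epigraph_def)
  moreover have "?S \<inter> epigraph UNIV f = {}" by (auto simp: epigraph_def)
  ultimately obtain z \<beta> where z: "z \<noteq> 0" "\<forall>x\<in>?S. z \<bullet> x \<le> \<beta>" "\<forall>x\<in>epigraph UNIV f. \<beta> \<le> z \<bullet> x"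
    using separating_hyperplane_sets[of ?S "epigraph UNIV f"] by auto
  obtain p q where pq: "z = (p, q)" by (cases z)
  have S: "p \<bullet> b + q * t \<le> \<beta>" if "t < f b" for t
    using z(2) that by (auto simp: pq)
  have T: "\<beta> \<le> p \<bullet> x + q * y" if "f x \<le> y" for x y
    using z(3) that by (auto simp: pq epigraph_def)
  have q0: "0 \<le> q"
    using S[of "f b - 1"] T[of b "f b"] by (simp add: algebra_simps)
  \<comment> \<open>The ray omits its top point, which is reached as a limit.\<close>
  have "p \<bullet> b + q * f b \<le> \<beta>"
  proof (rule tendsto_upperbound)
    show "((\<lambda>t. p \<bullet> b + q * t) \<longlongrightarrow> p \<bullet> b + q * f b) (at_left (f b))"
      by (intro tendsto_intros)
    show "\<forall>\<^sub>F t in at_left (f b). p \<bullet> b + q * t \<le> \<beta>"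
      using S by (auto simp: eventually_at_filter)
  qed simp
  then have le: "p \<bullet> b + q * f b \<le> p \<bullet> x + q * f x" for x
    using T[of x "f x"] by simp
  \<comment> \<open>With q = 0 every x would satisfy p . b <= p . x, which fails at x = b - p unless
    p = 0.\<close>
  have "q \<noteq> 0"
  proof
    assume "q = 0"
    with le[of "b - p"] have "p \<bullet> p \<le> 0" by (simp add: inner_diff_right)
    then have "p = 0" using inner_eq_zero_iff[of p] inner_ge_zero[of p] by linarith
    with \<open>q = 0\<close> z(1) show False by (simp add: pq zero_prod_def)
  qed
  with q0 have q: "q > 0" by simp
  have "f b + (- (1 / q) *\<^sub>R p) \<bullet> (x - b) \<le> f x" for x
    using le[of x] q by (simp add: field_simps inner_diff_right)
  then show thesis by (rule that)
qed

lemma convex_on_UNIV_borel: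
  fixes f :: "'a::euclidean_space \<Rightarrow> real"
  assumes "convex_on UNIV f"
  shows "f \<in> borel_measurable borel"
  using convex_on_continuous[OF open_UNIV assms] by (rule borel_measurable_continuous_onI)

lemma ext_integral_eq_integral:
  assumes "integrable M f"
  shows "ext_integral M f = ereal (\<integral>x. f x \<partial>M)"
proof -
  have "(\<integral>\<^sup>+x. ennreal (f x) \<partial>M) \<noteq> \<infinity>" "(\<integral>\<^sup>+x. ennreal (- f x) \<partial>M) \<noteq> \<infinity>"
    using assms by (auto simp: real_integrable_def)
  then show ?thesis
    unfolding ext_integral_def real_lebesgue_integral_def[OF assms]
    by (cases "\<integral>\<^sup>+x. ennreal (f x) \<partial>M"; cases "\<integral>\<^sup>+x. ennreal (- f x) \<partial>M")
       (auto simp: enn2ereal_ennreal)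
qed

lemma ext_integral_nonneg:
  assumes "\<And>x. 0 \<le> f x"
  shows "ext_integral M f = enn2ereal (\<integral>\<^sup>+x. ennreal (f x) \<partial>M)"
proof -
  have "(\<integral>\<^sup>+x. ennreal (- f x) \<partial>M) = 0"
    using assms by (simp add: ennreal_neg)
  then show ?thesis
    by (simp add: ext_integral_def zero_ennreal.rep_eq minus_ereal_def)
qed

section \<open>Measures with finite second moment as laws of random vectors\<close>

lemma P2_D:
  assumes "\<eta> \<in> P2"
  shows "prob_space \<eta>" "sets \<eta> = sets borel" "space \<eta> = UNIV" "sq_integrable \<eta> (\<lambda>x. x)"
proof -
  show s: "prob_space \<eta>" "sets \<eta> = sets borel" using assms by (auto simp: P2_def)
  from sets_eq_imp_space_eq[OF s(2)] show "space \<eta> = UNIV" by simp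
  from s(2) have "(\<lambda>x. x) \<in> borel_measurable \<eta>" by (simp cong: measurable_cong_sets)
  then show "sq_integrable \<eta> (\<lambda>x. x)" using assms by (simp add: P2_def sq_integrable_def)
qed

lemma distr_P2_id:
  assumes "\<mu> \<in> P2"
  shows "distr \<mu> borel (\<lambda>x. x) = \<mu>"
  using P2_D(2)[OF assms] by (intro distr_id2) simp

lemma (in prob_space) distr_in_P2:
  assumes X: "sq_integrable M X"
  shows "distr M borel X \<in> P2"
proof -
  have [measurable]: "X \<in> borel_measurable M" using X by (simp add: sq_integrable_def)
  have "prob_space (distr M borel X)" by (rule prob_space_distr) simp
  then show ?thesis
    using X by (auto simp: P2_def sq_integrable_def integrable_distr_eq)
qed

lemma mean_distr:
  assumes [measurable]: "X \<in> borel_measurable M"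
  shows "mean (distr M borel X) = (\<integral>w. X w \<partial>M)"
  unfolding mean_def by (rule integral_distr) simp_all

lemma norm_affine_power2:
  fixes x y :: "'a::real_inner"
  shows "(norm ((1 - t) *\<^sub>R x + t *\<^sub>R y))\<^sup>2
    = (1 - t) * (norm x)\<^sup>2 + t * (norm y)\<^sup>2 - t * (1 - t) * (norm (x - y))\<^sup>2"
  by (simp add: power2_norm_eq_inner inner_add_left inner_add_right inner_diff_left
      inner_diff_right inner_commute algebra_simps)

lemma convex_on_norm_diff_power2: "convex_on UNIV (\<lambda>x::'a::real_inner. (norm (x - c))\<^sup>2)"
proof (rule convex_onI)
  fix t :: real and x y :: 'a assume t: "0 < t" "t < 1"
  have "(1 - t) *\<^sub>R x + t *\<^sub>R y - c = (1 - t) *\<^sub>R (x - c) + t *\<^sub>R (y - c)"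
    by (simp add: algebra_simps)
  then show "(norm ((1 - t) *\<^sub>R x + t *\<^sub>R y - c))\<^sup>2
      \<le> (1 - t) * (norm (x - c))\<^sup>2 + t * (norm (y - c))\<^sup>2"
    using t by (simp add: norm_affine_power2)
qed simp

lemma sq_integrable_nn_integral:
  assumes "sq_integrable M X"
  shows "(\<integral>\<^sup>+w. ennreal ((norm (X w))\<^sup>2) \<partial>M) = ennreal ((L2_norm M X)\<^sup>2)"
  unfolding L2_norm_power2 using assms
  by (intro nn_integral_eq_integral) (auto simp: sq_integrable_def)

lemma (in prob_space) L2_norm_diff_const_power2:
  assumes X: "sq_integrable M X"
  shows "(L2_norm M (\<lambda>w. X w - c))\<^sup>2 = (L2_norm M X)\<^sup>2 - 2 * (c \<bullet> (\<integral>w. X w \<partial>M)) + (norm c)\<^sup>2"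
proof -
  have i: "integrable M X" using X by (rule sq_integrable_integrable)
  have "(L2_norm M (\<lambda>w. X w - c))\<^sup>2
      = (\<integral>w. (norm (X w))\<^sup>2 - 2 * (c \<bullet> X w) + (norm c)\<^sup>2 \<partial>M)"
    unfolding L2_norm_power2
    by (intro Bochner_Integration.integral_cong refl)
       (simp add: power2_norm_eq_inner inner_diff_left inner_diff_right inner_commute)
  also have "\<dots> = (L2_norm M X)\<^sup>2 - 2 * (c \<bullet> (\<integral>w. X w \<partial>M)) + (norm c)\<^sup>2"
    using X i by (simp add: L2_norm_power2 sq_integrable_def prob_space)
  finally show ?thesis .
qed

section \<open>Convex order tested on nonnegative convex functions\<close>

text \<open>For nonnegative test functions the extended integral is a nonnegative Lebesgue integral,
  to which Jensen and Fatou apply without integrability conditions. On \<open>P2\<close> this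
  restricted order is the convex order, by \<open>convex_order_iff_nonneg\<close>.\<close>

definition nonneg_convex_order :: "'a::euclidean_space measure \<Rightarrow> 'a measure \<Rightarrow> bool" where
  "nonneg_convex_order \<eta> \<nu> \<longleftrightarrow> (\<forall>g. convex_on UNIV g \<longrightarrow> (\<forall>x. 0 \<le> g x) \<longrightarrow>
     (\<integral>\<^sup>+x. ennreal (g x) \<partial>\<eta>) \<le> (\<integral>\<^sup>+x. ennreal (g x) \<partial>\<nu>))"

lemma convex_order_refl: "\<nu> \<le>\<^sub>c\<^sub>x \<nu>"
  by (simp add: convex_order_def)

lemma convex_order_imp_nonneg:
  assumes "\<eta> \<le>\<^sub>c\<^sub>x \<nu>"
  shows "nonneg_convex_order \<eta> \<nu>"
  unfolding nonneg_convex_order_def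
proof (intro allI impI)
  fix g :: "'a \<Rightarrow> real" assume g: "convex_on UNIV g" "\<forall>x. 0 \<le> g x"
  then have "ext_integral \<eta> g \<le> ext_integral \<nu> g" using assms by (auto simp: convex_order_def)
  then show "(\<integral>\<^sup>+x. ennreal (g x) \<partial>\<eta>) \<le> (\<integral>\<^sup>+x. ennreal (g x) \<partial>\<nu>)"
    using g(2) by (simp add: ext_integral_nonneg less_eq_ennreal.rep_eq)
qed

lemma nonneg_convex_order_L2_norm:
  assumes "nonneg_convex_order \<eta> \<nu>" "\<eta> \<in> P2" "\<nu> \<in> P2"
  shows "L2_norm \<eta> (\<lambda>x. x - c) \<le> L2_norm \<nu> (\<lambda>x. x - c)"
proof -
  interpret \<eta>: prob_space \<eta> using assms by (auto dest: P2_D)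
  interpret \<nu>: prob_space \<nu> using assms by (auto dest: P2_D)
  have sq: "sq_integrable \<eta> (\<lambda>x. x - c)" "sq_integrable \<nu> (\<lambda>x. x - c)"
    using assms by (auto intro!: sq_integrable_diff P2_D \<eta>.sq_integrable_const \<nu>.sq_integrable_const)
  have "(\<integral>\<^sup>+x. ennreal ((norm (x - c))\<^sup>2) \<partial>\<eta>) \<le> (\<integral>\<^sup>+x. ennreal ((norm (x - c))\<^sup>2) \<partial>\<nu>)"
    using assms(1) convex_on_norm_diff_power2[of c] by (auto simp: nonneg_convex_order_def)
  then have "(L2_norm \<eta> (\<lambda>x. x - c))\<^sup>2 \<le> (L2_norm \<nu> (\<lambda>x. x - c))\<^sup>2"
    using sq by (simp add: sq_integrable_nn_integral)
  then show ?thesis by (rule power2_le_imp_le) (rule L2_norm_nonneg)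
qed

text \<open>Linear functions are not nonnegative, but |x - t d|^2 is. Its term t^2 |d|^2 is common
  to both measures, so for large t the linear part -2 t (d . x) dominates the comparison.\<close>

lemma nonneg_convex_order_mean:
  assumes "nonneg_convex_order \<eta> \<nu>" and \<eta>: "\<eta> \<in> P2" and \<nu>: "\<nu> \<in> P2"
  shows "mean \<eta> = mean \<nu>"
proof (rule ccontr)
  interpret \<eta>: prob_space \<eta> using \<eta> by (rule P2_D)
  interpret \<nu>: prob_space \<nu> using \<nu> by (rule P2_D)
  assume "mean \<eta> \<noteq> mean \<nu>"
  define d where "d = mean \<nu> - mean \<eta>"
  define K where "K = (L2_norm \<nu> (\<lambda>x. x))\<^sup>2 - (L2_norm \<eta> (\<lambda>x. x))\<^sup>2"
  have d: "(norm d)\<^sup>2 > 0" using \<open>mean \<eta> \<noteq> mean \<nu>\<close> by (simp add: d_def)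
  have K: "2 * t * (norm d)\<^sup>2 \<le> K" for t
  proof -
    have "(L2_norm \<eta> (\<lambda>x. x - t *\<^sub>R d))\<^sup>2 \<le> (L2_norm \<nu> (\<lambda>x. x - t *\<^sub>R d))\<^sup>2"
      by (intro power_mono nonneg_convex_order_L2_norm assms L2_norm_nonneg)
    then have "2 * t * (d \<bullet> mean \<nu>) - 2 * t * (d \<bullet> mean \<eta>) \<le> K"
      using \<eta>.L2_norm_diff_const_power2[OF P2_D(4)[OF \<eta>], of "t *\<^sub>R d"]
        \<nu>.L2_norm_diff_const_power2[OF P2_D(4)[OF \<nu>], of "t *\<^sub>R d"]
      by (simp add: K_def mean_def)
    then show ?thesis
      by (simp add: d_def power2_norm_eq_inner inner_diff_left inner_diff_right algebra_simps)
  qed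
  \<comment> \<open>This value of t turns the bound into 2 (|K| + 1) <= K.\<close>
  have "2 * ((\<bar>K\<bar> + 1) / (norm d)\<^sup>2) * (norm d)\<^sup>2 = 2 * (\<bar>K\<bar> + 1)"
    using d by simp
  with K[of "(\<bar>K\<bar> + 1) / (norm d)\<^sup>2"] show False by simp
qed

text \<open>An integrable minorant confines all infinities to the nonnegative remainder f - l. If
  the integral of the remainder is infinite, then so is that of the positive part of
  \<open>f\<close>, while the negative part stays below |l|.\<close>

lemma ext_integral_affine_minorant:
  assumes l: "integrable M l" and [measurable]: "f \<in> borel_measurable M"
    and le: "\<And>x. l x \<le> f x"
  shows "ext_integral M f
    = ereal (\<integral>x. l x \<partial>M) + enn2ereal (\<integral>\<^sup>+x. ennreal (f x - l x) \<partial>M)"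
proof (cases "(\<integral>\<^sup>+x. ennreal (f x - l x) \<partial>M) = \<infinity>")
  case True
  have [measurable]: "l \<in> borel_measurable M" using l by simp
  have lfin: "(\<integral>\<^sup>+x. ennreal \<bar>l x\<bar> \<partial>M) < \<infinity>"
    using l by (simp add: integrable_iff_bounded)
  have "(\<integral>\<^sup>+x. ennreal (f x - l x) \<partial>M) \<le> (\<integral>\<^sup>+x. ennreal (f x) + ennreal \<bar>l x\<bar> \<partial>M)"
  proof (rule nn_integral_mono)
    fix x
    have "f x - l x \<le> max 0 (f x) + \<bar>l x\<bar>" by auto
    then have "ennreal (f x - l x) \<le> ennreal (max 0 (f x) + \<bar>l x\<bar>)" by (rule ennreal_leI)
    also have "\<dots> = ennreal (max 0 (f x)) + ennreal \<bar>l x\<bar>" by (rule ennreal_plus) auto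
    finally show "ennreal (f x - l x) \<le> ennreal (f x) + ennreal \<bar>l x\<bar>" by simp
  qed
  also have "\<dots> = (\<integral>\<^sup>+x. ennreal (f x) \<partial>M) + (\<integral>\<^sup>+x. ennreal \<bar>l x\<bar> \<partial>M)"
    by (rule nn_integral_add) auto
  finally have "(\<integral>\<^sup>+x. ennreal (f x) \<partial>M) = \<infinity>"
    using True lfin by (auto simp: top_unique)
  moreover have "(\<integral>\<^sup>+x. ennreal (- f x) \<partial>M) \<le> (\<integral>\<^sup>+x. ennreal \<bar>l x\<bar> \<partial>M)"
    by (intro nn_integral_mono ennreal_leI) (use le in \<open>smt (verit)\<close>)
  with lfin have "(\<integral>\<^sup>+x. ennreal (- f x) \<partial>M) < \<infinity>" by (rule order.strict_trans1[rotated])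
  ultimately show ?thesis
    using True unfolding ext_integral_def
    by (cases "\<integral>\<^sup>+x. ennreal (- f x) \<partial>M") (auto simp: enn2ereal_ennreal)
next
  case False
  have [measurable]: "l \<in> borel_measurable M" using l by simp
  have g: "integrable M (\<lambda>x. f x - l x)"
    using False le by (intro integrableI_nonneg) (auto simp: less_top)
  then have "integrable M (\<lambda>x. (f x - l x) + l x)" using l by (rule Bochner_Integration.integrable_add)
  then have f: "integrable M f" by simp
  have "(\<integral>\<^sup>+x. ennreal (f x - l x) \<partial>M) = ennreal (\<integral>x. f x - l x \<partial>M)"
    using g le by (intro nn_integral_eq_integral) auto
  then show ?thesis
    using f l le by (simp add: ext_integral_eq_integral enn2ereal_ennreal integral_mono)
qed

text \<open>Subtracting a supporting affine function at 0 leaves a nonnegative convex function; the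
  affine part has the same integral under both measures because their means agree.\<close>

lemma convex_order_iff_nonneg:
  assumes \<eta>: "\<eta> \<in> P2" and \<nu>: "\<nu> \<in> P2"
  shows "\<eta> \<le>\<^sub>c\<^sub>x \<nu> \<longleftrightarrow> nonneg_convex_order \<eta> \<nu>"
proof
  assume R: "nonneg_convex_order \<eta> \<nu>"
  interpret \<eta>: prob_space \<eta> using \<eta> by (rule P2_D)
  interpret \<nu>: prob_space \<nu> using \<nu> by (rule P2_D)
  show "\<eta> \<le>\<^sub>c\<^sub>x \<nu>"
    unfolding convex_order_def
  proof (intro allI impI)
    fix f :: "'a \<Rightarrow> real" assume f: "convex_on UNIV f"
    then obtain a where a: "\<And>x. f 0 + a \<bullet> (x - 0) \<le> f x" using convex_on_subgradient[OF f, of 0] by blast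
    let ?l = "\<lambda>x. f 0 + a \<bullet> x"
    have "convex_on UNIV (\<lambda>x. - ?l x)"
      by (rule convex_onI) (auto simp: algebra_simps)
    from convex_on_add[OF f this] have "convex_on UNIV (\<lambda>x. f x - ?l x)" by (simp only: diff_conv_add_uminus)
    then have g: "(\<integral>\<^sup>+x. ennreal (f x - ?l x) \<partial>\<eta>) \<le> (\<integral>\<^sup>+x. ennreal (f x - ?l x) \<partial>\<nu>)"
      using R[unfolded nonneg_convex_order_def, rule_format, of "\<lambda>x. f x - ?l x"] a by simp
    have i: "integrable \<eta> (\<lambda>x. x)" "integrable \<nu> (\<lambda>x. x)"
      using \<eta> \<nu> by (auto intro: \<eta>.sq_integrable_integrable \<nu>.sq_integrable_integrable P2_D)
    have "(\<integral>x. ?l x \<partial>\<eta>) = f 0 + a \<bullet> mean \<eta>" "(\<integral>x. ?l x \<partial>\<nu>) = f 0 + a \<bullet> mean \<nu>"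
      using i by (simp_all add: mean_def \<eta>.prob_space \<nu>.prob_space)
    moreover have "f \<in> borel_measurable \<eta>" "f \<in> borel_measurable \<nu>"
      using convex_on_UNIV_borel[OF f] P2_D(2)[OF \<eta>] P2_D(2)[OF \<nu>]
      by (auto cong: measurable_cong_sets)
    ultimately show "ext_integral \<eta> f \<le> ext_integral \<nu> f"
      using i g a nonneg_convex_order_mean[OF R \<eta> \<nu>]
      by (simp add: ext_integral_affine_minorant[where l="?l"] less_eq_ennreal.rep_eq add_left_mono)
  qed
qed (rule convex_order_imp_nonneg)

lemma convex_order_integral_le:
  assumes "\<mu> \<le>\<^sub>c\<^sub>x \<nu>" "convex_on UNIV h" "integrable \<mu> h" "integrable \<nu> h"
  shows "(\<integral>x. h x \<partial>\<mu>) \<le> (\<integral>x. h x \<partial>\<nu>)"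
  using assms by (auto simp: convex_order_def ext_integral_eq_integral)

lemma convex_order_mean:
  "\<eta> \<le>\<^sub>c\<^sub>x \<nu> \<Longrightarrow> \<eta> \<in> P2 \<Longrightarrow> \<nu> \<in> P2 \<Longrightarrow> mean \<eta> = mean \<nu>"
  by (intro nonneg_convex_order_mean convex_order_imp_nonneg)

text \<open>The set of laws below \<open>\<nu>\<close> is convex along arbitrary, not only optimal, interpolations.\<close>

lemma (in prob_space) convex_order_interpolate:
  fixes X Y :: "'a \<Rightarrow> 'v::euclidean_space"
  assumes X: "sq_integrable M X" and Y: "sq_integrable M Y" and \<nu>: "\<nu> \<in> P2"
    and t: "0 \<le> t" "t \<le> 1"
    and Xc: "distr M borel X \<le>\<^sub>c\<^sub>x \<nu>" and Yc: "distr M borel Y \<le>\<^sub>c\<^sub>x \<nu>"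
  shows "distr M borel (\<lambda>w. (1 - t) *\<^sub>R X w + t *\<^sub>R Y w) \<le>\<^sub>c\<^sub>x \<nu>"
proof -
  have [measurable]: "X \<in> borel_measurable M" "Y \<in> borel_measurable M"
    using X Y by (auto simp: sq_integrable_def)
  let ?Z = "\<lambda>w. (1 - t) *\<^sub>R X w + t *\<^sub>R Y w"
  have Z: "sq_integrable M ?Z" by (intro sq_integrable_add sq_integrable_scaleR X Y)
  show ?thesis
    unfolding convex_order_iff_nonneg[OF distr_in_P2[OF Z] \<nu>] nonneg_convex_order_def
  proof (intro allI impI)
    fix g :: "'v \<Rightarrow> real" assume g: "convex_on UNIV g" and pos: "\<forall>x. 0 \<le> g x"
    have [measurable]: "g \<in> borel_measurable borel" using g by (rule convex_on_UNIV_borel)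
    let ?I = "\<integral>\<^sup>+x. ennreal (g x) \<partial>\<nu>"
    have le: "(\<integral>\<^sup>+w. ennreal (g (V w)) \<partial>M) \<le> ?I"
      if "distr M borel V \<le>\<^sub>c\<^sub>x \<nu>" and [measurable]: "V \<in> borel_measurable M" for V
      using convex_order_imp_nonneg[OF that(1)] g pos
      by (auto simp: nonneg_convex_order_def nn_integral_distr)
    have "(\<integral>\<^sup>+x. ennreal (g x) \<partial>distr M borel ?Z) = (\<integral>\<^sup>+w. ennreal (g (?Z w)) \<partial>M)"
      by (simp add: nn_integral_distr)
    also have "\<dots> \<le> (\<integral>\<^sup>+w. ennreal (1 - t) * ennreal (g (X w)) + ennreal t * ennreal (g (Y w)) \<partial>M)"
    proof (rule nn_integral_mono)
      fix w
      have "g (?Z w) \<le> (1 - t) * g (X w) + t * g (Y w)"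
        using convex_onD[OF g, of t "X w" "Y w"] t by simp
      then have "ennreal (g (?Z w)) \<le> ennreal ((1 - t) * g (X w) + t * g (Y w))"
        by (rule ennreal_leI)
      also have "\<dots> = ennreal (1 - t) * ennreal (g (X w)) + ennreal t * ennreal (g (Y w))"
        using t pos by (simp add: ennreal_plus ennreal_mult)
      finally show "ennreal (g (?Z w)) \<le> \<dots>" .
    qed
    also have "\<dots> = ennreal (1 - t) * (\<integral>\<^sup>+w. ennreal (g (X w)) \<partial>M)
        + ennreal t * (\<integral>\<^sup>+w. ennreal (g (Y w)) \<partial>M)"
      by (simp add: nn_integral_add nn_integral_cmult)
    also have "\<dots> \<le> ennreal (1 - t) * ?I + ennreal t * ?I"
      by (intro add_mono mult_left_mono le Xc Yc) auto
    also have "\<dots> = (ennreal (1 - t) + ennreal t) * ?I" by (simp add: distrib_right)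
    also have "ennreal (1 - t) + ennreal t = 1"
      using t by (simp flip: ennreal_plus)
    finally show "(\<integral>\<^sup>+x. ennreal (g x) \<partial>distr M borel ?Z) \<le> ?I" by simp
  qed
qed

subsection \<open>Couplings and the Wasserstein distance\<close>

lemma couplings_D:
  fixes \<mu> \<nu> :: "'a::euclidean_space measure"
  assumes \<pi>: "\<pi> \<in> couplings \<mu> \<nu>"
  shows "prob_space \<pi>" "sets \<pi> = sets (borel \<Otimes>\<^sub>M borel)"
    "fst \<in> borel_measurable \<pi>" "snd \<in> borel_measurable \<pi>"
    "distr \<pi> borel fst = \<mu>" "distr \<pi> borel snd = \<nu>"
proof -
  show s: "prob_space \<pi>" "sets \<pi> = sets (borel \<Otimes>\<^sub>M borel)"
    "distr \<pi> borel fst = \<mu>" "distr \<pi> borel snd = \<nu>"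
    using \<pi> by (auto simp: couplings_def)
  show "fst \<in> borel_measurable \<pi>" "snd \<in> borel_measurable \<pi>"
    using measurable_fst[of borel borel] measurable_snd[of borel borel] s(2)
    by (auto cong: measurable_cong_sets)
qed

lemma couplings_sq_integrable:
  assumes \<pi>: "\<pi> \<in> couplings \<mu> \<nu>" and "\<mu> \<in> P2" "\<nu> \<in> P2"
  shows "sq_integrable \<pi> fst" "sq_integrable \<pi> snd"
proof -
  note [measurable] = couplings_D(3,4)[OF \<pi>]
  have "sq_integrable (distr \<pi> borel fst) (\<lambda>x. x)" "sq_integrable (distr \<pi> borel snd) (\<lambda>x. x)"
    using assms by (auto simp: couplings_D intro: P2_D)
  then show "sq_integrable \<pi> fst" "sq_integrable \<pi> snd"
    by (simp_all add: sq_integrable_distr)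
qed

text \<open>The law of the pair (X, Y) is a coupling. All later upper bounds on \<open>W2\<close>
  are obtained in this way.\<close>

lemma (in prob_space) W2_distr_le:
  assumes X: "sq_integrable M X" and Y: "sq_integrable M Y"
  shows "W2 (distr M borel X) (distr M borel Y) \<le> L2_norm M (\<lambda>w. X w - Y w)"
proof -
  have [measurable]: "X \<in> borel_measurable M" "Y \<in> borel_measurable M"
    using X Y by (auto simp: sq_integrable_def)
  define \<pi> where "\<pi> = distr M (borel \<Otimes>\<^sub>M borel) (\<lambda>w. (X w, Y w))"
  have "\<pi> \<in> couplings (distr M borel X) (distr M borel Y)"
    unfolding couplings_def \<pi>_def
    by (auto simp: distr_distr comp_def intro!: prob_space_distr)
  then have "(INF \<pi>\<in>couplings (distr M borel X) (distr M borel Y).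
      \<integral>\<^sup>+ (x, y). ennreal ((norm (x - y))\<^sup>2) \<partial>\<pi>) \<le> (\<integral>\<^sup>+ (x, y). ennreal ((norm (x - y))\<^sup>2) \<partial>\<pi>)"
    by (rule INF_lower)
  also have "\<dots> = (\<integral>\<^sup>+ w. ennreal ((norm (X w - Y w))\<^sup>2) \<partial>M)"
    unfolding \<pi>_def by (subst nn_integral_distr) (auto simp: split_beta')
  also have "\<dots> = ennreal ((L2_norm M (\<lambda>w. X w - Y w))\<^sup>2)"
    using sq_integrable_nn_integral[OF sq_integrable_diff[OF X Y]] .
  finally have "(W2 (distr M borel X) (distr M borel Y))\<^sup>2 \<le> (L2_norm M (\<lambda>w. X w - Y w))\<^sup>2"
    unfolding W2_def by (simp add: enn2real_leI)
  then show ?thesis by (rule power2_le_imp_le) (rule L2_norm_nonneg)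
qed

lemma W2_nonneg: "0 \<le> W2 \<mu> \<nu>"
  by (simp add: W2_def)

text \<open>Supplies one coupling, whose cost is finite on \<open>P2\<close>, so that the infimum in
  \<open>W2\<close> is finite and \<open>enn2real\<close> does not distort it.\<close>

lemma pair_measure_couplings:
  assumes \<mu>: "\<mu> \<in> P2" and \<nu>: "\<nu> \<in> P2"
  shows "\<mu> \<Otimes>\<^sub>M \<nu> \<in> couplings \<mu> \<nu>"
proof -
  interpret \<mu>: prob_space \<mu> using \<mu> by (rule P2_D)
  interpret \<nu>: prob_space \<nu> using \<nu> by (rule P2_D)
  interpret P: pair_prob_space \<mu> \<nu> ..
  note s = P2_D(2)[OF \<mu>] P2_D(2)[OF \<nu>] P2_D(3)[OF \<mu>] P2_D(3)[OF \<nu>]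
  have m: "fst \<in> \<mu> \<Otimes>\<^sub>M \<nu> \<rightarrow>\<^sub>M borel" "snd \<in> \<mu> \<Otimes>\<^sub>M \<nu> \<rightarrow>\<^sub>M borel"
    using measurable_fst[of \<mu> \<nu>] measurable_snd[of \<mu> \<nu>] s by (auto cong: measurable_cong_sets)
  have "distr (\<mu> \<Otimes>\<^sub>M \<nu>) borel fst = \<mu>"
  proof (rule measure_eqI)
    fix A assume "A \<in> sets (distr (\<mu> \<Otimes>\<^sub>M \<nu>) borel fst)"
    then have A: "A \<in> sets borel" by simp
    have "fst -` A \<inter> space (\<mu> \<Otimes>\<^sub>M \<nu>) = A \<times> UNIV" by (auto simp: space_pair_measure s)
    then show "emeasure (distr (\<mu> \<Otimes>\<^sub>M \<nu>) borel fst) A = emeasure \<mu> A"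
      using A m s \<nu>.emeasure_space_1
      by (simp add: emeasure_distr \<nu>.emeasure_pair_measure_Times)
  qed (simp add: s)
  moreover have "distr (\<mu> \<Otimes>\<^sub>M \<nu>) borel snd = \<nu>"
  proof (rule measure_eqI)
    fix A assume "A \<in> sets (distr (\<mu> \<Otimes>\<^sub>M \<nu>) borel snd)"
    then have A: "A \<in> sets borel" by simp
    have "snd -` A \<inter> space (\<mu> \<Otimes>\<^sub>M \<nu>) = UNIV \<times> A" by (auto simp: space_pair_measure s)
    then show "emeasure (distr (\<mu> \<Otimes>\<^sub>M \<nu>) borel snd) A = emeasure \<nu> A"
      using A m s \<mu>.emeasure_space_1
      by (simp add: emeasure_distr \<nu>.emeasure_pair_measure_Times)
  qed (simp add: s)
  moreover have "sets (\<mu> \<Otimes>\<^sub>M \<nu>) = sets (borel \<Otimes>\<^sub>M borel)"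
    using s by (intro sets_pair_measure_cong) auto
  ultimately show ?thesis
    by (simp add: couplings_def P.prob_space_axioms)
qed

lemma W2_near_optimal:
  assumes \<mu>: "\<mu> \<in> P2" and \<nu>: "\<nu> \<in> P2" and e: "e > 0"
  obtains \<pi> where "\<pi> \<in> couplings \<mu> \<nu>" "L2_norm \<pi> (\<lambda>w. fst w - snd w) < W2 \<mu> \<nu> + e"
proof -
  let ?c = "\<lambda>\<pi>. \<integral>\<^sup>+ (x, y). ennreal ((norm (x - y))\<^sup>2) \<partial>(\<pi> :: ('a \<times> 'a) measure)"
  let ?I = "INF \<pi>\<in>couplings \<mu> \<nu>. ?c \<pi>"
  have c: "?c \<pi> = ennreal ((L2_norm \<pi> (\<lambda>w. fst w - snd w))\<^sup>2)" if "\<pi> \<in> couplings \<mu> \<nu>" for \<pi>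
    using sq_integrable_nn_integral[OF sq_integrable_diff[OF couplings_sq_integrable[OF that \<mu> \<nu>]]]
    by (simp add: split_beta')
  have "?I \<le> ?c (\<mu> \<Otimes>\<^sub>M \<nu>)" by (intro INF_lower pair_measure_couplings \<mu> \<nu>)
  also have "\<dots> < \<infinity>" by (simp add: c[OF pair_measure_couplings[OF \<mu> \<nu>]])
  finally have fin: "?I < \<infinity>" .
  then have I: "?I = ennreal ((W2 \<mu> \<nu>)\<^sup>2)" by (simp add: W2_def)
  have "(W2 \<mu> \<nu>)\<^sup>2 < (W2 \<mu> \<nu> + e)\<^sup>2"
    using e W2_nonneg[of \<mu> \<nu>] by (intro power_strict_mono) auto
  then have "?I < ennreal ((W2 \<mu> \<nu> + e)\<^sup>2)"
    unfolding I using e W2_nonneg[of \<mu> \<nu>] by (intro ennreal_lessI) auto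
  then obtain \<pi> where \<pi>: "\<pi> \<in> couplings \<mu> \<nu>" "?c \<pi> < ennreal ((W2 \<mu> \<nu> + e)\<^sup>2)"
    by (auto simp: INF_less_iff)
  then have "(L2_norm \<pi> (\<lambda>w. fst w - snd w))\<^sup>2 < (W2 \<mu> \<nu> + e)\<^sup>2"
    by (simp add: c ennreal_less_iff)
  from power2_less_imp_less[OF this] have "L2_norm \<pi> (\<lambda>w. fst w - snd w) < W2 \<mu> \<nu> + e"
    using e W2_nonneg[of \<mu> \<nu>] by simp
  with \<pi> that show ?thesis by blast
qed

text \<open>Couplings of arbitrarily small cost force the integrals of a Lipschitz function under
  the two measures to agree. Lipschitz cut-offs of the distance to a closed set converge to its
  indicator, and the closed sets are an intersection-stable generator of the Borel sets.\<close>

lemma W2_eq_0_imp_eq: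
  assumes \<mu>: "\<mu> \<in> P2" and \<nu>: "\<nu> \<in> P2" and W: "W2 \<mu> \<nu> = 0"
  shows "\<mu> = \<nu>"
proof -
  interpret \<mu>: prob_space \<mu> using \<mu> by (rule P2_D)
  interpret \<nu>: prob_space \<nu> using \<nu> by (rule P2_D)
  note s[simp] = P2_D(2)[OF \<mu>] P2_D(2)[OF \<nu>]
  note s'[simp] = P2_D(3)[OF \<mu>] P2_D(3)[OF \<nu>]
  have closed_eq: "emeasure \<mu> F = emeasure \<nu> F" if F: "closed F" for F
  proof (cases "F = {}")
    case False
    define g where "g n x = max 0 (1 - real n * infdist x F)" for n x
    have g_cont: "continuous_on UNIV (g n)" for n
      unfolding g_def by (intro continuous_intros)
    have g_meas [measurable]: "g n \<in> borel_measurable borel" for n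
      using g_cont by (rule borel_measurable_continuous_onI)
    have g_meas' [measurable]: "g n \<in> borel_measurable \<mu>" "g n \<in> borel_measurable \<nu>" for n
      using g_meas by (auto cong: measurable_cong_sets)
    have g01: "0 \<le> g n x" "g n x \<le> 1" for n x
      by (auto simp: g_def infdist_nonneg)
    have g_lip: "g n x - g n y \<le> real n * dist x y" for n x y
    proof -
      have "infdist y F - infdist x F \<le> dist x y"
        using infdist_triangle[of y F x] by (simp add: dist_commute)
      then have "real n * (infdist y F - infdist x F) \<le> real n * dist x y"
        by (intro mult_left_mono) auto
      moreover have "0 \<le> real n * dist x y" by simp
      moreover have "max 0 (1 - a) - max 0 (1 - b) \<le> c" if "b - a \<le> c" "0 \<le> c" for a b c :: real
        using that by (auto simp: max_def)
      ultimately show ?thesis unfolding g_def right_diff_distrib by blast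
    qed
    have gi: "integrable M (\<lambda>w. g n (X w))"
      if "prob_space M" and [measurable]: "X \<in> borel_measurable M" for n X and M :: "'c measure"
    proof -
      interpret prob_space M by fact
      show ?thesis
        by (intro integrable_const_bound[where B=1]) (use g01 in auto)
    qed
    have g_eq: "(\<integral>x. g n x \<partial>\<mu>) = (\<integral>x. g n x \<partial>\<nu>)" for n
    proof -
      have "\<bar>(\<integral>x. g n x \<partial>\<mu>) - (\<integral>x. g n x \<partial>\<nu>)\<bar> \<le> 0 + e" if e: "e > 0" for e
      proof -
        \<comment> \<open>\<open>g n\<close> is n-Lipschitz, so this accuracy of the coupling costs
          at most e in the integrals; the + 1 covers n = 0.\<close>
        have "e / (real n + 1) > 0" using e by simp
        then obtain \<pi> where \<pi>: "\<pi> \<in> couplings \<mu> \<nu>"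
            "L2_norm \<pi> (\<lambda>w. fst w - snd w) < W2 \<mu> \<nu> + e / (real n + 1)"
          using W2_near_optimal[OF \<mu> \<nu>] by blast
        interpret \<pi>: prob_space \<pi> using \<pi>(1) by (rule couplings_D)
        note [measurable] = couplings_D(3,4)[OF \<pi>(1)]
        note sq = couplings_sq_integrable[OF \<pi>(1) \<mu> \<nu>]
        have i: "integrable \<pi> (\<lambda>w. norm (fst w - snd w))"
          by (intro integrable_norm \<pi>.sq_integrable_integrable sq_integrable_diff sq)
        have "(\<integral>x. g n x \<partial>distr \<pi> borel fst) = (\<integral>w. g n (fst w) \<partial>\<pi>)"
             "(\<integral>x. g n x \<partial>distr \<pi> borel snd) = (\<integral>w. g n (snd w) \<partial>\<pi>)"
          by (simp_all add: integral_distr)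
        then have "\<bar>(\<integral>x. g n x \<partial>\<mu>) - (\<integral>x. g n x \<partial>\<nu>)\<bar> = \<bar>\<integral>w. g n (fst w) - g n (snd w) \<partial>\<pi>\<bar>"
          using gi[OF \<pi>.prob_space_axioms] couplings_D[OF \<pi>(1)] by simp
        also have "\<dots> \<le> (\<integral>w. \<bar>g n (fst w) - g n (snd w)\<bar> \<partial>\<pi>)"
          by (rule integral_abs_bound)
        also have "\<dots> \<le> (\<integral>w. real n * norm (fst w - snd w) \<partial>\<pi>)"
        proof (rule integral_mono)
          show "integrable \<pi> (\<lambda>w. \<bar>g n (fst w) - g n (snd w)\<bar>)"
            using gi[OF \<pi>.prob_space_axioms] by auto
          show "\<bar>g n (fst w) - g n (snd w)\<bar> \<le> real n * norm (fst w - snd w)" for w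
            using g_lip[of n "fst w" "snd w"] g_lip[of n "snd w" "fst w"]
            by (simp add: dist_norm norm_minus_commute)
        qed (use i in auto)
        also have "\<dots> = real n * (\<integral>w. norm (fst w - snd w) \<partial>\<pi>)" by simp
        also have "\<dots> \<le> real n * (e / (real n + 1))"
          using \<pi>.expectation_norm_le_L2_norm[OF sq_integrable_diff[OF sq]] \<pi>(2) W
          by (intro mult_left_mono) auto
        also have "\<dots> \<le> e" using e by (simp add: field_simps)
        finally show ?thesis by simp
      qed
      then have "\<bar>(\<integral>x. g n x \<partial>\<mu>) - (\<integral>x. g n x \<partial>\<nu>)\<bar> \<le> 0" by (rule field_le_epsilon)
      then show ?thesis by simp
    qed
    have g_lim: "(\<lambda>n. g n x) \<longlonglongrightarrow> indicator F x" for x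
    proof (cases "x \<in> F")
      case True
      then show ?thesis by (simp add: g_def)
    next
      case nF: False
      \<comment> \<open>Closedness enters here: a point outside \<open>F\<close> has positive
        distance from it, so \<open>g n\<close> vanishes there for large n.\<close>
      then have pos: "infdist x F > 0"
        using F False in_closed_iff_infdist_zero[of F x] infdist_nonneg[of x F] by (auto simp: less_le)
      obtain N where N: "1 / infdist x F < real N" using reals_Archimedean2 by blast
      have "g n x = 0" if "n \<ge> N" for n
      proof -
        have "1 / infdist x F < real n" using N that by simp
        then show ?thesis using pos by (simp add: g_def field_simps)
      qed
      then show ?thesis
        using nF by (intro tendsto_eventually) (auto simp: eventually_sequentially)
    qed
    have lim: "(\<lambda>n. \<integral>x. g n x \<partial>M) \<longlonglongrightarrow> measure M F"
      if "prob_space M" and [simp]: "sets M = sets borel" for M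
    proof -
      interpret prob_space M by fact
      have [measurable]: "g n \<in> borel_measurable M" for n
        using g_meas by (auto cong: measurable_cong_sets)
      have [measurable]: "F \<in> sets M" using F by (simp add: borel_closed)
      have "(\<lambda>n. \<integral>x. g n x \<partial>M) \<longlonglongrightarrow> (\<integral>x. indicator F x \<partial>M)"
        by (rule integral_dominated_convergence[where w="\<lambda>_. 1"]) (use g01 g_lim in auto)
      then show ?thesis using sets.sets_into_space[OF \<open>F \<in> sets M\<close>] by (simp add: Int_absorb2)
    qed
    have "measure \<mu> F = measure \<nu> F"
      using lim[OF \<mu>.prob_space_axioms] lim[OF \<nu>.prob_space_axioms] g_eq
      by (intro LIMSEQ_unique[of "\<lambda>n. \<integral>x. g n x \<partial>\<mu>"]) auto
    then show ?thesis by (simp add: \<mu>.emeasure_eq_measure \<nu>.emeasure_eq_measure)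
  qed simp
  have "sets borel = sigma_sets UNIV (Collect closed :: 'a set set)"
    unfolding borel_eq_closed by (simp add: sets_measure_of)
  then show ?thesis
    using closed_eq
    by (intro measure_eqI_generator_eq[where E="Collect closed" and \<Omega>=UNIV and A="\<lambda>_. UNIV"])
       (auto simp: Int_stable_def \<mu>.emeasure_eq_measure)
qed

subsection \<open>Averaging over the cells of a simple function\<close>

text \<open>The conditional expectation of \<open>Z\<close> given \<open>s\<close>, written as a
  function of the value of \<open>s\<close>. On a cell of measure zero, 1 / 0 = 0 makes it
  0.\<close>

definition cell_mean :: "'b measure \<Rightarrow> ('b \<Rightarrow> 'c) \<Rightarrow> ('b \<Rightarrow> 'a::euclidean_space) \<Rightarrow> 'c \<Rightarrow> 'a" where
  "cell_mean M s Z v = (1 / measure M (s -` {v} \<inter> space M)) *\<^sub>R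
     (\<integral>w. indicator (s -` {v} \<inter> space M) w *\<^sub>R Z w \<partial>M)"

context prob_space
begin

lemma simple_function_eq_sum:
  fixes f :: "'c \<Rightarrow> 'v::real_vector"
  assumes s: "simple_function M s" and w: "w \<in> space M"
  shows "f (s w) = (\<Sum>v\<in>s ` space M. indicator (s -` {v} \<inter> space M) w *\<^sub>R f v)"
proof -
  have "(\<Sum>v\<in>s ` space M. indicator (s -` {v} \<inter> space M) w *\<^sub>R f v)
      = (\<Sum>v\<in>s ` space M. if v = s w then f v else 0)"
    using w by (intro sum.cong) auto
  also have "\<dots> = f (s w)"
    using w simple_functionD(1)[OF s] by (simp add: sum.delta)
  finally show ?thesis by simp
qed

lemma integrable_cell:
  assumes s: "simple_function M s"
  shows "integrable M (indicat_real (s -` {v} \<inter> space M))"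
  by (rule integrable_real_indicator[OF simple_functionD(2)[OF s]]) (simp add: emeasure_eq_measure)

lemma integral_simple_compose:
  fixes f :: "'c \<Rightarrow> 'v::euclidean_space"
  assumes s: "simple_function M s"
  shows "integrable M (\<lambda>w. f (s w))"
    and "(\<integral>w. f (s w) \<partial>M) = (\<Sum>v\<in>s ` space M. prob (s -` {v} \<inter> space M) *\<^sub>R f v)"
proof -
  note [measurable] = simple_functionD(2)[OF s]
  have i: "integrable M (\<lambda>w. indicator (s -` {v} \<inter> space M) w *\<^sub>R f v)" for v
    by (intro integrable_scaleR_left integrable_cell[OF s])
  have i': "integrable M (\<lambda>w. \<Sum>v\<in>s ` space M. indicator (s -` {v} \<inter> space M) w *\<^sub>R f v)"
    by (intro Bochner_Integration.integrable_sum i)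
  then show "integrable M (\<lambda>w. f (s w))"
    by (subst Bochner_Integration.integrable_cong[OF refl simple_function_eq_sum[OF s]])
  have "(\<integral>w. f (s w) \<partial>M)
      = (\<integral>w. (\<Sum>v\<in>s ` space M. indicator (s -` {v} \<inter> space M) w *\<^sub>R f v) \<partial>M)"
    by (intro Bochner_Integration.integral_cong refl simple_function_eq_sum[OF s])
  also have "\<dots> = (\<Sum>v\<in>s ` space M. prob (s -` {v} \<inter> space M) *\<^sub>R f v)"
    by (subst Bochner_Integration.integral_sum[OF i]) (simp add: integrable_cell[OF s] Int_absorb2)
  finally show "(\<integral>w. f (s w) \<partial>M) = (\<Sum>v\<in>s ` space M. prob (s -` {v} \<inter> space M) *\<^sub>R f v)" .
qed

lemma integrable_indicator_cell:
  fixes Z :: "'a \<Rightarrow> 'v::euclidean_space"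
  assumes s: "simple_function M s" and Z: "integrable M Z"
  shows "integrable M (\<lambda>w. indicator (s -` {v} \<inter> space M) w *\<^sub>R Z w)"
  using simple_functionD(2)[OF s] Z by (intro integrable_mult_indicator)

text \<open>Undoes the division in \<open>cell_mean\<close>; on null cells both sides vanish, so the
  default value does no harm.\<close>

lemma prob_scaleR_cell_mean:
  assumes s: "simple_function M s"
  shows "prob (s -` {v} \<inter> space M) *\<^sub>R cell_mean M s Z v
    = (\<integral>w. indicator (s -` {v} \<inter> space M) w *\<^sub>R Z w \<partial>M)"
proof (cases "prob (s -` {v} \<inter> space M) = 0")
  case True
  then have "s -` {v} \<inter> space M \<in> null_sets M"
    using simple_functionD(2)[OF s] by (auto simp: null_sets_def emeasure_eq_measure)
  then have "AE w in M. w \<notin> s -` {v} \<inter> space M" by (rule AE_not_in)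
  then have "(\<integral>w. indicator (s -` {v} \<inter> space M) w *\<^sub>R Z w \<partial>M) = 0"
    by (intro integral_eq_zero_AE) auto
  with True show ?thesis by simp
qed (simp add: cell_mean_def)

text \<open>The characteristic property of a conditional expectation: the residual of
  \<open>Z\<close> is orthogonal to every function of \<open>s\<close>, as is checked cell by cell.
  Jensen's inequality and best approximation below rest on it.\<close>

lemma cell_mean_orthogonal:
  fixes Z :: "'a \<Rightarrow> 'v::euclidean_space"
  assumes s: "simple_function M s" and Z: "integrable M Z"
  shows "integrable M (\<lambda>w. a (s w) \<bullet> (Z w - cell_mean M s Z (s w)))"
    and "(\<integral>w. a (s w) \<bullet> (Z w - cell_mean M s Z (s w)) \<partial>M) = 0"
proof -
  let ?A = "\<lambda>v. s -` {v} \<inter> space M"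
  let ?m = "cell_mean M s Z"
  let ?f = "\<lambda>v w. a v \<bullet> (indicator (?A v) w *\<^sub>R Z w) - indicator (?A v) w * (a v \<bullet> ?m v)"
  note [measurable] = simple_functionD(2)[OF s]
  have eq: "a (s w) \<bullet> (Z w - ?m (s w)) = (\<Sum>v\<in>s ` space M. ?f v w)" if "w \<in> space M" for w
    using simple_function_eq_sum[OF s that, of "\<lambda>v. a v \<bullet> (Z w - ?m v)"]
    by (simp add: inner_diff_right algebra_simps)
  have i: "integrable M (?f v)" for v
    by (intro Bochner_Integration.integrable_diff integrable_inner_right integrable_mult_left
        integrable_indicator_cell[OF s Z] integrable_cell[OF s])
  have "integrable M (\<lambda>w. \<Sum>v\<in>s ` space M. ?f v w)"
    by (intro Bochner_Integration.integrable_sum i)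
  then show "integrable M (\<lambda>w. a (s w) \<bullet> (Z w - ?m (s w)))"
    by (subst Bochner_Integration.integrable_cong[OF refl eq])
  have "(\<integral>w. a (s w) \<bullet> (Z w - ?m (s w)) \<partial>M) = (\<integral>w. (\<Sum>v\<in>s ` space M. ?f v w) \<partial>M)"
    by (intro Bochner_Integration.integral_cong refl eq)
  also have "\<dots> = (\<Sum>v\<in>s ` space M. \<integral>w. ?f v w \<partial>M)"
    by (rule Bochner_Integration.integral_sum[OF i])
  also have "\<dots> = (\<Sum>v\<in>s ` space M. 0)"
  proof (rule sum.cong)
    fix v
    have "(\<integral>w. ?f v w \<partial>M)
        = a v \<bullet> (\<integral>w. indicator (?A v) w *\<^sub>R Z w \<partial>M) - prob (?A v) * (a v \<bullet> ?m v)"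
      by (subst Bochner_Integration.integral_diff)
         (simp_all add: integrable_indicator_cell[OF s Z] integrable_cell[OF s] Int_absorb2
           del: inner_scaleR_right)
    also have "\<dots> = 0" by (simp flip: prob_scaleR_cell_mean[OF s])
    finally show "(\<integral>w. ?f v w \<partial>M) = 0" .
  qed simp
  finally show "(\<integral>w. a (s w) \<bullet> (Z w - ?m (s w)) \<partial>M) = 0" by simp
qed

lemma sq_integrable_simple_compose:
  "simple_function M s \<Longrightarrow> sq_integrable M (\<lambda>w. f (s w))"
  by (rule sq_integrable_simple[OF simple_function_compose1])

text \<open>The subgradient inequality of \<open>h\<close> at the cell mean is integrated; its
  linear term pairs a function of \<open>s\<close> with the residual and so integrates to 0.\<close>

lemma cell_mean_jensen:
  fixes Z :: "'a \<Rightarrow> 'v::euclidean_space"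
  assumes s: "simple_function M s" and Z: "integrable M Z"
    and h: "convex_on UNIV h" and hZ: "integrable M (\<lambda>w. h (Z w))"
  shows "(\<integral>w. h (cell_mean M s Z (s w)) \<partial>M) \<le> (\<integral>w. h (Z w) \<partial>M)"
proof -
  let ?m = "cell_mean M s Z"
  have "\<exists>a. \<forall>x. h b + a \<bullet> (x - b) \<le> h x" for b
    using convex_on_subgradient[OF h, of b] by blast
  then obtain a where a: "\<And>b x. h b + a b \<bullet> (x - b) \<le> h x" by metis
  note o = cell_mean_orthogonal[OF s Z, of "\<lambda>v. a (?m v)"]
  note i = integral_simple_compose(1)[OF s, of "\<lambda>v. h (?m v)"]
  have "(\<integral>w. h (?m (s w)) \<partial>M) = (\<integral>w. h (?m (s w)) + a (?m (s w)) \<bullet> (Z w - ?m (s w)) \<partial>M)"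
    using o i by simp
  also have "\<dots> \<le> (\<integral>w. h (Z w) \<partial>M)"
    by (intro integral_mono hZ Bochner_Integration.integrable_add i o(1) a)
  finally show ?thesis .
qed

lemma cell_mean_jensen_nn:
  fixes Z :: "'a \<Rightarrow> 'v::euclidean_space"
  assumes s: "simple_function M s" and Z: "integrable M Z"
    and g: "convex_on UNIV g" "\<And>x. 0 \<le> g x"
  shows "(\<integral>\<^sup>+w. ennreal (g (cell_mean M s Z (s w))) \<partial>M) \<le> (\<integral>\<^sup>+w. ennreal (g (Z w)) \<partial>M)"
proof (cases "(\<integral>\<^sup>+w. ennreal (g (Z w)) \<partial>M) = \<infinity>")
  case False
  have [measurable]: "Z \<in> borel_measurable M" "g \<in> borel_measurable borel"
    using Z convex_on_UNIV_borel[OF g(1)] by auto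
  have gZ: "integrable M (\<lambda>w. g (Z w))"
    using False g(2) by (intro integrableI_nonneg) (auto simp: less_top)
  show ?thesis
    using cell_mean_jensen[OF s Z g(1) gZ] gZ integral_simple_compose(1)[OF s, of "\<lambda>v. g (cell_mean M s Z v)"] g(2)
    by (simp add: nn_integral_eq_integral)
qed simp

lemma cell_mean_diff:
  fixes Y Z :: "'a \<Rightarrow> 'v::euclidean_space"
  assumes s: "simple_function M s" and Y: "integrable M Y" and Z: "integrable M Z"
  shows "cell_mean M s (\<lambda>w. Y w - Z w) v = cell_mean M s Y v - cell_mean M s Z v"
  using integrable_indicator_cell[OF s Y, of v] integrable_indicator_cell[OF s Z, of v]
  by (simp add: cell_mean_def scaleR_diff_right)

text \<open>Jensen for the convex function |z|^2.\<close>

lemma cell_mean_contraction: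
  fixes Z :: "'a \<Rightarrow> 'v::euclidean_space"
  assumes s: "simple_function M s" and Z: "sq_integrable M Z"
  shows "L2_norm M (\<lambda>w. cell_mean M s Z (s w)) \<le> L2_norm M Z"
  unfolding L2_norm_def
proof (rule real_sqrt_le_mono)
  show "(\<integral>w. (norm (cell_mean M s Z (s w)))\<^sup>2 \<partial>M) \<le> (\<integral>w. (norm (Z w))\<^sup>2 \<partial>M)"
    using cell_mean_jensen[OF s sq_integrable_integrable[OF Z] convex_on_norm_diff_power2[of 0]] Z
    by (simp add: sq_integrable_def)
qed

text \<open>The cell averages are the best approximation of \<open>Z\<close> by functions of \<open>s\<close>, in particular
  better than \<open>s\<close> itself.\<close>

lemma cell_mean_approx:
  fixes Z :: "'a \<Rightarrow> 'v::euclidean_space"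
  assumes s: "simple_function M s" and Z: "sq_integrable M Z"
  shows "L2_norm M (\<lambda>w. Z w - cell_mean M s Z (s w)) \<le> L2_norm M (\<lambda>w. Z w - s w)"
proof (rule power2_le_imp_le)
  let ?m = "cell_mean M s Z"
  note i = sq_integrable_integrable[OF Z]
  note o = cell_mean_orthogonal[OF s i, of "\<lambda>v. ?m v - v"]
  have 1: "sq_integrable M (\<lambda>w. Z w - ?m (s w))" "sq_integrable M (\<lambda>w. ?m (s w) - s w)"
    by (intro sq_integrable_diff Z sq_integrable_simple_compose[OF s, of ?m] sq_integrable_simple[OF s])+
  have "(L2_norm M (\<lambda>w. Z w - s w))\<^sup>2 = (\<integral>w. (norm (Z w - ?m (s w)))\<^sup>2
      + 2 * ((?m (s w) - s w) \<bullet> (Z w - ?m (s w))) + (norm (?m (s w) - s w))\<^sup>2 \<partial>M)"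
    unfolding L2_norm_power2
    by (intro Bochner_Integration.integral_cong refl)
       (simp add: power2_norm_eq_inner inner_diff_left inner_diff_right inner_commute algebra_simps)
  also have "\<dots> = (L2_norm M (\<lambda>w. Z w - ?m (s w)))\<^sup>2 + (L2_norm M (\<lambda>w. ?m (s w) - s w))\<^sup>2"
    using o 1 by (simp add: L2_norm_power2 sq_integrable_def)
  finally show "(L2_norm M (\<lambda>w. Z w - ?m (s w)))\<^sup>2 \<le> (L2_norm M (\<lambda>w. Z w - s w))\<^sup>2" by simp
qed (rule L2_norm_nonneg)

end

subsection \<open>The projection is the law of a deterministic map\<close>

lemma simple_function_P2_borel:
  assumes "\<mu> \<in> P2" "simple_function \<mu> s"
  shows "simple_function borel s"
  using assms P2_D(2,3)[OF assms(1)] unfolding simple_function_def by simp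

text \<open>Averaging over the cells of a fine simple function of X costs little. Writing X0 and Y0
  for the cell means of X and Y, so that T X = Y0, one has |X - T X| <= |X - X0| + |X0 - Y0|. The
  first term is at most |X - s X|; the second is the norm of the cell mean of X - Y, hence at most
  |X - Y|. Each error takes e / 2.\<close>

lemma approx_projection_map:
  assumes \<mu>: "\<mu> \<in> P2" and \<eta>: "\<eta> \<in> P2" and \<nu>: "\<nu> \<in> P2" and cx: "\<eta> \<le>\<^sub>c\<^sub>x \<nu>" and e: "e > 0"
  obtains T where "sq_integrable \<mu> T" "distr \<mu> borel T \<le>\<^sub>c\<^sub>x \<nu>"
    "L2_norm \<mu> (\<lambda>x. x - T x) < W2 \<mu> \<eta> + e"
proof -
  interpret \<mu>: prob_space \<mu> using \<mu> by (rule P2_D)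
  obtain \<pi> where \<pi>: "\<pi> \<in> couplings \<mu> \<eta>" "L2_norm \<pi> (\<lambda>w. fst w - snd w) < W2 \<mu> \<eta> + e / 2"
    using W2_near_optimal[OF \<mu> \<eta>, of "e / 2"] e by auto
  interpret \<pi>: prob_space \<pi> using \<pi>(1) by (rule couplings_D)
  note [measurable] = couplings_D(3,4)[OF \<pi>(1)]
  note sq = couplings_sq_integrable[OF \<pi>(1) \<mu> \<eta>]
  obtain s where s: "simple_function \<mu> s" "L2_norm \<mu> (\<lambda>x. x - s x) < e / 2"
    using simple_function_L2_dense[OF P2_D(4)[OF \<mu>], of "e / 2"] e by auto
  have sb: "simple_function borel s" by (rule simple_function_P2_borel[OF \<mu> s(1)])
  define S where "S w = s (fst w)" for w :: "'a \<times> 'a"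
  have S: "simple_function \<pi> S"
    unfolding S_def by (rule simple_function_comp[OF _ sb]) simp
  define T where "T x = cell_mean \<pi> S snd (s x)" for x
  have T_sf: "simple_function borel T"
    unfolding T_def using sb by (rule simple_function_compose1)
  have [measurable]: "T \<in> borel_measurable borel" "s \<in> borel_measurable borel"
    using T_sf sb by (auto intro: borel_measurable_simple_function)
  have TS: "T (fst w) = cell_mean \<pi> S snd (S w)" for w by (simp add: T_def S_def)
  have \<mu>_eq: "\<mu> = distr \<pi> borel fst" and \<eta>_eq: "\<eta> = distr \<pi> borel snd"
    using couplings_D[OF \<pi>(1)] by auto
  have T1: "sq_integrable \<pi> (\<lambda>w. T (fst w))"
    unfolding TS by (rule \<pi>.sq_integrable_simple_compose[OF S])
  have T2: "sq_integrable \<mu> T"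
    unfolding \<mu>_eq using T1 by (simp add: sq_integrable_distr)
  have "nonneg_convex_order (distr \<mu> borel T) \<nu>"
    unfolding nonneg_convex_order_def
  proof (intro allI impI)
    fix g :: "'a \<Rightarrow> real" assume g: "convex_on UNIV g" "\<forall>x. 0 \<le> g x"
    have [measurable]: "g \<in> borel_measurable borel" using g(1) by (rule convex_on_UNIV_borel)
    have "(\<integral>\<^sup>+x. ennreal (g x) \<partial>distr \<mu> borel T) = (\<integral>\<^sup>+w. ennreal (g (cell_mean \<pi> S snd (S w))) \<partial>\<pi>)"
      unfolding \<mu>_eq by (simp add: nn_integral_distr distr_distr TS)
    also have "\<dots> \<le> (\<integral>\<^sup>+w. ennreal (g (snd w)) \<partial>\<pi>)"
      using g by (intro \<pi>.cell_mean_jensen_nn S \<pi>.sq_integrable_integrable sq) auto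
    also have "\<dots> = (\<integral>\<^sup>+x. ennreal (g x) \<partial>\<eta>)"
      unfolding \<eta>_eq by (simp add: nn_integral_distr)
    also have "\<dots> \<le> (\<integral>\<^sup>+x. ennreal (g x) \<partial>\<nu>)"
      using convex_order_imp_nonneg[OF cx] g by (auto simp: nonneg_convex_order_def)
    finally show "(\<integral>\<^sup>+x. ennreal (g x) \<partial>distr \<mu> borel T) \<le> (\<integral>\<^sup>+x. ennreal (g x) \<partial>\<nu>)" .
  qed
  then have T3: "distr \<mu> borel T \<le>\<^sub>c\<^sub>x \<nu>"
    using convex_order_iff_nonneg[OF \<mu>.distr_in_P2[OF T2] \<nu>] by simp
  let ?m = "\<lambda>w. cell_mean \<pi> S fst (S w)"
  have "L2_norm \<mu> (\<lambda>x. x - T x) = L2_norm \<pi> (\<lambda>w. fst w - T (fst w))"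
    unfolding \<mu>_eq by (simp add: L2_norm_distr)
  also have "\<dots> \<le> L2_norm \<pi> (\<lambda>w. fst w - ?m w) + L2_norm \<pi> (\<lambda>w. ?m w - T (fst w))"
    by (intro L2_norm_triangle sq T1 \<pi>.sq_integrable_simple_compose[OF S])
  also have "(\<lambda>w. ?m w - T (fst w)) = (\<lambda>w. cell_mean \<pi> S (\<lambda>w. fst w - snd w) (S w))"
    unfolding TS by (simp add: \<pi>.cell_mean_diff[OF S] \<pi>.sq_integrable_integrable sq)
  also have "L2_norm \<pi> \<dots> \<le> L2_norm \<pi> (\<lambda>w. fst w - snd w)"
    by (intro \<pi>.cell_mean_contraction S sq_integrable_diff sq)
  also have "L2_norm \<pi> (\<lambda>w. fst w - ?m w) \<le> L2_norm \<pi> (\<lambda>w. fst w - S w)"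
    by (intro \<pi>.cell_mean_approx S sq)
  also have "L2_norm \<pi> (\<lambda>w. fst w - S w) = L2_norm \<mu> (\<lambda>x. x - s x)"
    unfolding \<mu>_eq S_def by (simp add: L2_norm_distr)
  finally have "L2_norm \<mu> (\<lambda>x. x - T x) < W2 \<mu> \<eta> + e" using s(2) \<pi>(2) by simp
  with T2 T3 that show ?thesis by blast
qed

text \<open>The Hilbert space identity for a point on a segment. Its negative last term drives the
  arguments below: at t = 1/2 it makes near minimizers close to each other, and as t tends to 0 it
  gives the obtuse angle condition.\<close>

lemma L2_norm_affine_power2:
  assumes X: "sq_integrable M X" and Y: "sq_integrable M Y" and Z: "sq_integrable M Z"
  shows "(L2_norm M (\<lambda>w. X w - ((1 - t) *\<^sub>R Y w + t *\<^sub>R Z w)))\<^sup>2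
    = (1 - t) * (L2_norm M (\<lambda>w. X w - Y w))\<^sup>2 + t * (L2_norm M (\<lambda>w. X w - Z w))\<^sup>2
      - t * (1 - t) * (L2_norm M (\<lambda>w. Y w - Z w))\<^sup>2"
proof -
  have eq: "(norm (X w - ((1 - t) *\<^sub>R Y w + t *\<^sub>R Z w)))\<^sup>2
      = (1 - t) * (norm (X w - Y w))\<^sup>2 + t * (norm (X w - Z w))\<^sup>2 - t * (1 - t) * (norm (Y w - Z w))\<^sup>2"
    for w
    using norm_affine_power2[of t "X w - Y w" "X w - Z w"]
    by (simp add: algebra_simps norm_minus_commute)
  have "sq_integrable M (\<lambda>w. X w - Y w)" "sq_integrable M (\<lambda>w. X w - Z w)" "sq_integrable M (\<lambda>w. Y w - Z w)"
    by (intro sq_integrable_diff X Y Z)+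
  then show ?thesis
    unfolding L2_norm_power2 eq by (simp add: sq_integrable_def)
qed

text \<open>Fatou's lemma. It serves twice: with a convex test function it keeps a limit of maps
  below \<nu>, with the squared norm it keeps the limit at minimal distance.\<close>

lemma nn_integral_limit_le:
  fixes Z :: "nat \<Rightarrow> 'b \<Rightarrow> 'v::euclidean_space"
  assumes [measurable]: "\<And>i. Z i \<in> borel_measurable M"
    and lim: "AE w in M. (\<lambda>i. Z i w) \<longlonglongrightarrow> Y w"
    and g: "continuous_on UNIV g"
    and B: "\<And>i. (\<integral>\<^sup>+w. ennreal (g (Z i w)) \<partial>M) \<le> B"
  shows "(\<integral>\<^sup>+w. ennreal (g (Y w)) \<partial>M) \<le> B"
proof -
  have [measurable]: "g \<in> borel_measurable borel" using g by (rule borel_measurable_continuous_onI)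
  have "AE w in M. ennreal (g (Y w)) = liminf (\<lambda>i. ennreal (g (Z i w)))"
    using lim
  proof eventually_elim
    case (elim w)
    have "(\<lambda>i. ennreal (g (Z i w))) \<longlonglongrightarrow> ennreal (g (Y w))"
      using elim g by (intro tendsto_ennrealI continuous_on_tendsto_compose[OF g]) auto
    then show ?case by (simp add: lim_imp_Liminf)
  qed
  then have "(\<integral>\<^sup>+w. ennreal (g (Y w)) \<partial>M) = (\<integral>\<^sup>+w. liminf (\<lambda>i. ennreal (g (Z i w))) \<partial>M)"
    by (rule nn_integral_cong_AE)
  also have "\<dots> \<le> liminf (\<lambda>i. \<integral>\<^sup>+w. ennreal (g (Z i w)) \<partial>M)"
    by (rule nn_integral_liminf) simp
  also have "\<dots> \<le> liminf (\<lambda>i. B)"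
    by (intro Liminf_mono always_eventually allI B)
  finally show ?thesis by (simp add: Liminf_const)
qed

section \<open>Existence of the projection map\<close>

text \<open>\<open>T\<close> has to beat every competing measure, not just laws of maps, and in
  terms of \<open>W2\<close>. Hence its law is a minimizer and the coupling induced by
  \<open>T\<close> is optimal.\<close>

definition is_projection_map ::
    "'a::euclidean_space measure \<Rightarrow> 'a measure \<Rightarrow> ('a \<Rightarrow> 'a) \<Rightarrow> bool" where
  "is_projection_map \<mu> \<nu> T \<longleftrightarrow> sq_integrable \<mu> T \<and> distr \<mu> borel T \<le>\<^sub>c\<^sub>x \<nu> \<and>
     (\<forall>\<eta>\<in>P2. \<eta> \<le>\<^sub>c\<^sub>x \<nu> \<longrightarrow> L2_norm \<mu> (\<lambda>x. x - T x) \<le> W2 \<mu> \<eta>)"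

text \<open>Parallelogram law: two points at distance at most D + e from X whose midpoint is at
  distance at least D are close; the bound is 4 (D + e)^2 - 4 D^2. It gives both the Cauchy property
  of minimizing sequences and uniqueness of the minimizer.\<close>

lemma L2_norm_midpoint:
  assumes X: "sq_integrable M X" and Y: "sq_integrable M Y" and Z: "sq_integrable M Z"
    and D: "D \<le> L2_norm M (\<lambda>w. X w - ((1 - 1/2) *\<^sub>R Y w + (1/2) *\<^sub>R Z w))" "0 \<le> D"
    and YK: "L2_norm M (\<lambda>w. X w - Y w) \<le> D + e" and ZK: "L2_norm M (\<lambda>w. X w - Z w) \<le> D + e"
  shows "(L2_norm M (\<lambda>w. Y w - Z w))\<^sup>2 \<le> 4 * (2 * D * e + e\<^sup>2)"
proof -
  have "D\<^sup>2 \<le> (L2_norm M (\<lambda>w. X w - ((1 - 1/2) *\<^sub>R Y w + (1/2) *\<^sub>R Z w)))\<^sup>2"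
    using D by (rule power_mono)
  also have "\<dots> = (1/2) * (L2_norm M (\<lambda>w. X w - Y w))\<^sup>2 + (1/2) * (L2_norm M (\<lambda>w. X w - Z w))\<^sup>2
      - (1/4) * (L2_norm M (\<lambda>w. Y w - Z w))\<^sup>2"
    by (subst L2_norm_affine_power2[OF X Y Z]) simp
  finally have "(L2_norm M (\<lambda>w. Y w - Z w))\<^sup>2
      \<le> 2 * (L2_norm M (\<lambda>w. X w - Y w))\<^sup>2 + 2 * (L2_norm M (\<lambda>w. X w - Z w))\<^sup>2 - 4 * D\<^sup>2"
    by simp
  also have "\<dots> \<le> 2 * (D + e)\<^sup>2 + 2 * (D + e)\<^sup>2 - 4 * D\<^sup>2"
    by (intro diff_right_mono add_mono mult_left_mono power_mono YK ZK) (simp_all add: L2_norm_nonneg)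
  finally show ?thesis by (simp add: power2_eq_square algebra_simps)
qed

lemma small_quadratic:
  fixes D :: real
  assumes e: "e > 0" and D: "0 \<le> D"
  obtains d where "d > 0" "4 * (2 * D * d + d\<^sup>2) < e"
proof -
  have "((\<lambda>d. 4 * (2 * D * d + d\<^sup>2)) \<longlongrightarrow> 4 * (2 * D * 0 + 0\<^sup>2)) (at_right 0)"
    by (intro tendsto_intros)
  then have "\<forall>\<^sub>F d in at_right 0. 4 * (2 * D * d + d\<^sup>2) < e"
    using e by (intro order_tendstoD(2)) auto
  moreover have "\<forall>\<^sub>F d::real in at_right 0. d > 0"
    by (auto simp: eventually_at_filter)
  ultimately have "\<forall>\<^sub>F d in at_right 0. d > 0 \<and> 4 * (2 * D * d + d\<^sup>2) < e"
    by eventually_elim simp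
  then have "\<exists>d. d > 0 \<and> 4 * (2 * D * d + d\<^sup>2) < e"
    by (intro eventually_happens'[of "at_right (0::real)"]) auto
  with that show ?thesis by blast
qed

text \<open>A minimizing sequence can be taken among maps by \<open>approx_projection_map\<close>,
  and it is Cauchy in L^2 because midpoints of admissible maps are admissible. An almost sure limit
  along a subsequence suffices, since the order constraint and the distance both pass to it by
  Fatou.\<close>

lemma projection_map_exists:
  assumes \<mu>: "\<mu> \<in> P2" and \<nu>: "\<nu> \<in> P2"
  obtains T where "is_projection_map \<mu> \<nu> T"
proof -
  interpret \<mu>: prob_space \<mu> using \<mu> by (rule P2_D)
  let ?C = "{\<eta> \<in> P2. \<eta> \<le>\<^sub>c\<^sub>x \<nu>}"
  define D where "D = (INF \<eta>\<in>?C. W2 \<mu> \<eta>)"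
  have "\<nu> \<in> ?C" using \<nu> by (simp add: convex_order_refl)
  then have C_ne: "?C \<noteq> {}" by blast
  have bdd: "bdd_below (W2 \<mu> ` ?C)" by (auto intro!: bdd_belowI[of _ 0] simp: W2_nonneg)
  have D0: "0 \<le> D" unfolding D_def using C_ne by (intro cINF_greatest) (auto simp: W2_nonneg)
  have D_le: "D \<le> W2 \<mu> \<eta>" if "\<eta> \<in> ?C" for \<eta>
    unfolding D_def using bdd that by (rule cINF_lower)
  have X: "sq_integrable \<mu> (\<lambda>x. x)" using \<mu> by (rule P2_D)
  have D_le': "D \<le> L2_norm \<mu> (\<lambda>x. x - T x)" if T: "sq_integrable \<mu> T" "distr \<mu> borel T \<le>\<^sub>c\<^sub>x \<nu>" for T
    using \<mu>.W2_distr_le[OF X T(1)] D_le[of "distr \<mu> borel T"] \<mu>.distr_in_P2[OF T(1)] T(2)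
    by (simp add: distr_P2_id[OF \<mu>])
  have "\<exists>T. sq_integrable \<mu> T \<and> distr \<mu> borel T \<le>\<^sub>c\<^sub>x \<nu> \<and> L2_norm \<mu> (\<lambda>x. x - T x) < D + 1 / real (Suc n)"
    for n
  proof -
    have "D < D + 1 / real (Suc n) / 2" by simp
    then obtain \<eta> where \<eta>: "\<eta> \<in> ?C" "W2 \<mu> \<eta> < D + 1 / real (Suc n) / 2"
      unfolding D_def using cINF_less_iff[OF C_ne bdd] by blast
    have "1 / real (Suc n) / 2 > 0" by simp
    then obtain T where "sq_integrable \<mu> T" "distr \<mu> borel T \<le>\<^sub>c\<^sub>x \<nu>"
        "L2_norm \<mu> (\<lambda>x. x - T x) < W2 \<mu> \<eta> + 1 / real (Suc n) / 2"
      using approx_projection_map[OF \<mu> _ \<nu>, of \<eta>] \<eta>(1) by blast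
    with \<eta>(2) show ?thesis by (intro exI[of _ T]) (simp add: field_simps)
  qed
  then obtain T where T: "\<And>n. sq_integrable \<mu> (T n)" "\<And>n. distr \<mu> borel (T n) \<le>\<^sub>c\<^sub>x \<nu>"
      "\<And>n. L2_norm \<mu> (\<lambda>x. x - T n x) < D + 1 / real (Suc n)"
    by metis
  have [measurable]: "T n \<in> borel_measurable \<mu>" for n
    using T(1) by (rule sq_integrable_measurable)
  have D_conv: "\<exists>N. \<forall>n\<ge>N. L2_norm \<mu> (\<lambda>x. x - T n x) \<le> D + d" if d: "d > 0" for d
  proof -
    obtain N where N: "inverse (real (Suc N)) < d" using reals_Archimedean[OF d] by blast
    have "L2_norm \<mu> (\<lambda>x. x - T n x) \<le> D + d" if "n \<ge> N" for n
    proof -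
      have "1 / real (Suc n) \<le> inverse (real (Suc N))"
        using that by (simp add: field_simps)
      with T(3)[of n] N show ?thesis by simp
    qed
    then show ?thesis by blast
  qed
  obtain r where r: "strict_mono r" "AE x in \<mu>. Cauchy (\<lambda>i. T (r i) x)"
  proof (rule cauchy_L1_AE_cauchy_subseq[of \<mu> T])
    show "integrable \<mu> (T n)" for n using T(1) by (rule \<mu>.sq_integrable_integrable)
  next
    fix e :: real assume e: "e > 0"
    then have "e\<^sup>2 > 0" by simp
    from small_quadratic[OF this D0] obtain d where d: "d > 0" "4 * (2 * D * d + d\<^sup>2) < e\<^sup>2" .
    obtain N where N: "\<And>n. n \<ge> N \<Longrightarrow> L2_norm \<mu> (\<lambda>x. x - T n x) \<le> D + d"
      using D_conv[OF d(1)] by blast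
    have "(\<integral>x. norm (T i x - T j x) \<partial>\<mu>) < e" if "i \<ge> N" "j \<ge> N" for i j
    proof -
      have "(L2_norm \<mu> (\<lambda>x. T i x - T j x))\<^sup>2 \<le> 4 * (2 * D * d + d\<^sup>2)"
      proof (rule L2_norm_midpoint[OF X T(1) T(1) _ D0 N[OF that(1)] N[OF that(2)]])
        show "D \<le> L2_norm \<mu> (\<lambda>x. x - ((1 - 1/2) *\<^sub>R T i x + (1/2) *\<^sub>R T j x))"
          by (intro D_le' sq_integrable_add sq_integrable_scaleR T \<mu>.convex_order_interpolate \<nu>) auto
      qed
      with d(2) have "(L2_norm \<mu> (\<lambda>x. T i x - T j x))\<^sup>2 < e\<^sup>2" by simp
      from power2_less_imp_less[OF this] have "L2_norm \<mu> (\<lambda>x. T i x - T j x) < e"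
        using e by simp
      with \<mu>.expectation_norm_le_L2_norm[OF sq_integrable_diff[OF T(1) T(1)], of i j]
      show ?thesis by simp
    qed
    then show "\<exists>N. \<forall>i\<ge>N. \<forall>j\<ge>N. (\<integral>x. norm (T i x - T j x) \<partial>\<mu>) < e" by blast
  qed
  define S where "S x = lim (\<lambda>i. T (r i) x)" for x
  have S_meas [measurable]: "S \<in> borel_measurable \<mu>" unfolding S_def by measurable
  have S_lim: "AE x in \<mu>. (\<lambda>i. T (r i) x) \<longlonglongrightarrow> S x"
    using r(2)
  proof eventually_elim
    case (elim x)
    then show ?case by (simp add: S_def Cauchy_convergent_iff convergent_LIMSEQ_iff)
  qed
  have S_conv: "(\<integral>\<^sup>+x. ennreal (g (S x)) \<partial>\<mu>) \<le> (\<integral>\<^sup>+x. ennreal (g x) \<partial>\<nu>)"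
    if g: "convex_on UNIV g" "\<And>x. 0 \<le> g x" for g
  proof (rule nn_integral_limit_le[OF _ S_lim])
    have [measurable]: "g \<in> borel_measurable borel" using g(1) by (rule convex_on_UNIV_borel)
    show "continuous_on UNIV g" using open_UNIV g(1) by (rule convex_on_continuous)
    fix i
    show "(\<integral>\<^sup>+x. ennreal (g (T (r i) x)) \<partial>\<mu>) \<le> (\<integral>\<^sup>+x. ennreal (g x) \<partial>\<nu>)"
      using convex_order_imp_nonneg[OF T(2)[of "r i"], unfolded nonneg_convex_order_def, rule_format, OF g]
      by (simp add: nn_integral_distr)
  qed simp
  \<comment> \<open>The squared norm is itself a convex test function, so the second moment of \<nu>
    bounds that of the limit.\<close>
  have S_sq: "sq_integrable \<mu> S"
  proof -
    have "(\<integral>\<^sup>+x. ennreal ((norm (S x))\<^sup>2) \<partial>\<mu>) \<le> (\<integral>\<^sup>+x. ennreal ((norm x)\<^sup>2) \<partial>\<nu>)"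
      using S_conv[OF convex_on_norm_diff_power2[of 0]] by simp
    also have "\<dots> < \<infinity>" by (simp add: sq_integrable_nn_integral[OF P2_D(4)[OF \<nu>]])
    finally show ?thesis
      unfolding sq_integrable_def by (auto intro!: integrableI_nonneg)
  qed
  have "nonneg_convex_order (distr \<mu> borel S) \<nu>"
    unfolding nonneg_convex_order_def
    using S_conv by (auto simp: nn_integral_distr convex_on_UNIV_borel)
  then have S_cx: "distr \<mu> borel S \<le>\<^sub>c\<^sub>x \<nu>"
    using convex_order_iff_nonneg[OF \<mu>.distr_in_P2[OF S_sq] \<nu>] by simp
  have "L2_norm \<mu> (\<lambda>x. x - S x) \<le> D + d" if d: "d > 0" for d
  proof -
    obtain N where N: "\<And>n. n \<ge> N \<Longrightarrow> L2_norm \<mu> (\<lambda>x. x - T n x) \<le> D + d"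
      using D_conv[OF d] by blast
    have [measurable]: "(\<lambda>x. x) \<in> borel_measurable \<mu>" using X by (rule sq_integrable_measurable)
    have "(\<integral>\<^sup>+x. ennreal ((norm (x - S x))\<^sup>2) \<partial>\<mu>) \<le> ennreal ((D + d)\<^sup>2)"
    \<comment> \<open>The shift by \<open>N\<close> puts every term of the sequence within D + d,
      which is the uniform bound that Fatou asks for.\<close>
    proof (rule nn_integral_limit_le[where Z="\<lambda>i x. x - T (r (i + N)) x" and g="\<lambda>z. (norm z)\<^sup>2"])
      show "AE x in \<mu>. (\<lambda>i. x - T (r (i + N)) x) \<longlonglongrightarrow> x - S x"
        using S_lim
      proof eventually_elim
        case (elim x)
        then have "(\<lambda>i. T (r (i + N)) x) \<longlonglongrightarrow> S x" by (rule LIMSEQ_ignore_initial_segment)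
        then show ?case by (intro tendsto_diff tendsto_const)
      qed
      show "continuous_on UNIV (\<lambda>z::'a. (norm z)\<^sup>2)" by (intro continuous_intros)
      fix i
      have "N \<le> r (i + N)" using seq_suble[OF r(1), of "i + N"] by simp
      then have "(L2_norm \<mu> (\<lambda>x. x - T (r (i + N)) x))\<^sup>2 \<le> (D + d)\<^sup>2"
        by (intro power_mono N L2_norm_nonneg)
      then show "(\<integral>\<^sup>+x. ennreal ((norm (x - T (r (i + N)) x))\<^sup>2) \<partial>\<mu>) \<le> ennreal ((D + d)\<^sup>2)"
        by (subst sq_integrable_nn_integral[OF sq_integrable_diff[OF X T(1)]]) (rule ennreal_leI)
    qed simp
    then have "(L2_norm \<mu> (\<lambda>x. x - S x))\<^sup>2 \<le> (D + d)\<^sup>2"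
      by (subst (asm) sq_integrable_nn_integral[OF sq_integrable_diff[OF X S_sq]]) simp
    from power2_le_imp_le[OF this] show ?thesis using D0 d by simp
  qed
  then have "L2_norm \<mu> (\<lambda>x. x - S x) \<le> D" by (rule field_le_epsilon)
  then have "L2_norm \<mu> (\<lambda>x. x - S x) \<le> W2 \<mu> \<eta>" if "\<eta> \<in> P2" "\<eta> \<le>\<^sub>c\<^sub>x \<nu>" for \<eta>
    using D_le[of \<eta>] that by simp
  with S_sq S_cx that show ?thesis by (auto simp: is_projection_map_def)
qed

section \<open>Obtuse angle condition, uniqueness and nonexpansiveness\<close>

lemma is_projection_map_D:
  assumes "is_projection_map \<mu> \<nu> T" and \<mu>: "\<mu> \<in> P2"
  shows "sq_integrable \<mu> T" "T \<in> borel_measurable borel" "distr \<mu> borel T \<in> P2"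
    "distr \<mu> borel T \<le>\<^sub>c\<^sub>x \<nu>"
    "\<And>\<eta>. \<eta> \<in> P2 \<Longrightarrow> \<eta> \<le>\<^sub>c\<^sub>x \<nu> \<Longrightarrow> L2_norm \<mu> (\<lambda>x. x - T x) \<le> W2 \<mu> \<eta>"
    "W2 \<mu> (distr \<mu> borel T) = L2_norm \<mu> (\<lambda>x. x - T x)"
proof -
  interpret \<mu>: prob_space \<mu> using \<mu> by (rule P2_D)
  show sq: "sq_integrable \<mu> T" and cx: "distr \<mu> borel T \<le>\<^sub>c\<^sub>x \<nu>"
    and le: "\<And>\<eta>. \<eta> \<in> P2 \<Longrightarrow> \<eta> \<le>\<^sub>c\<^sub>x \<nu> \<Longrightarrow> L2_norm \<mu> (\<lambda>x. x - T x) \<le> W2 \<mu> \<eta>"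
    using assms by (auto simp: is_projection_map_def)
  show P: "distr \<mu> borel T \<in> P2" using sq by (rule \<mu>.distr_in_P2)
  show "T \<in> borel_measurable borel"
    using sq_integrable_measurable[OF sq] P2_D(2)[OF \<mu>] by (simp cong: measurable_cong_sets)
  show "W2 \<mu> (distr \<mu> borel T) = L2_norm \<mu> (\<lambda>x. x - T x)"
    using le[OF P cx] \<mu>.W2_distr_le[OF P2_D(4)[OF \<mu>] sq] by (simp add: distr_P2_id[OF \<mu>])
qed

text \<open>Minimality of \<open>T\<close> along the interpolation from \<open>T X\<close> to \<open>Z\<close> gives the obtuse angle
  condition of a projection onto a convex set.\<close>

lemma (in prob_space) projection_map_obtuse:
  fixes X Z :: "'a \<Rightarrow> 'v::euclidean_space"
  assumes T: "is_projection_map \<mu> \<nu> T" and \<mu>: "\<mu> \<in> P2" and \<nu>: "\<nu> \<in> P2"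
    and X: "X \<in> borel_measurable M" "distr M borel X = \<mu>"
    and Z: "sq_integrable M Z" "distr M borel Z \<le>\<^sub>c\<^sub>x \<nu>"
  shows "(\<integral>w. (X w - T (X w)) \<bullet> (Z w - T (X w)) \<partial>M) \<le> 0"
proof -
  note [measurable] = X(1) is_projection_map_D(2)[OF T \<mu>]
  let ?Y = "\<lambda>w. T (X w)"
  have Xs: "sq_integrable M X" and Ys: "sq_integrable M ?Y"
    using P2_D(4)[OF \<mu>] is_projection_map_D(1)[OF T \<mu>]
    unfolding X(2)[symmetric] by (simp_all add: sq_integrable_distr)
  have Yc: "distr M borel ?Y \<le>\<^sub>c\<^sub>x \<nu>"
    using is_projection_map_D(4)[OF T \<mu>] unfolding X(2)[symmetric] by (simp add: distr_distr comp_def)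
  define a where "a = (L2_norm M (\<lambda>w. X w - ?Y w))\<^sup>2"
  define b where "b = (L2_norm M (\<lambda>w. X w - Z w))\<^sup>2"
  define c where "c = (L2_norm M (\<lambda>w. ?Y w - Z w))\<^sup>2"
  have D: "L2_norm \<mu> (\<lambda>x. x - T x) = L2_norm M (\<lambda>w. X w - ?Y w)"
    unfolding X(2)[symmetric] by (simp add: L2_norm_distr)
  have "a \<le> b - (1 - t) * c" if t: "0 < t" "t < 1" for t
  proof -
    let ?V = "\<lambda>w. (1 - t) *\<^sub>R ?Y w + t *\<^sub>R Z w"
    have V: "sq_integrable M ?V" by (intro sq_integrable_add sq_integrable_scaleR Ys Z)
    have "distr M borel ?V \<le>\<^sub>c\<^sub>x \<nu>"
      using t by (intro convex_order_interpolate Ys Yc Z \<nu>) auto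
    then have "L2_norm M (\<lambda>w. X w - ?Y w) \<le> W2 \<mu> (distr M borel ?V)"
      using is_projection_map_D(5)[OF T \<mu> distr_in_P2[OF V]] by (simp add: D)
    also have "\<dots> \<le> L2_norm M (\<lambda>w. X w - ?V w)"
      using W2_distr_le[OF Xs V] by (simp add: X(2))
    finally have "a \<le> (L2_norm M (\<lambda>w. X w - ?V w))\<^sup>2"
      unfolding a_def by (intro power_mono L2_norm_nonneg)
    also have "\<dots> = (1 - t) * a + t * b - t * (1 - t) * c"
      unfolding a_def b_def c_def by (rule L2_norm_affine_power2[OF Xs Ys Z(1)])
    \<comment> \<open>Moving (1 - t) a to the left leaves a common factor t, which is cancelled
      before t tends to 0.\<close>
    finally have "t * a \<le> t * (b - (1 - t) * c)" by (simp add: algebra_simps)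
    then show ?thesis using t by simp
  qed
  then have "\<forall>\<^sub>F t in at_right 0. a \<le> b - (1 - t) * c"
    by (intro eventually_at_rightI[of 0 1]) auto
  moreover have "((\<lambda>t. b - (1 - t) * c) \<longlongrightarrow> b - (1 - 0) * c) (at_right 0)"
    by (intro tendsto_intros)
  ultimately have "a \<le> b - (1 - 0) * c" by (intro tendsto_lowerbound) auto
  \<comment> \<open>X - Z is expanded as (X - T X) - (Z - T X). Together with a <= b - c this
    determines the sign of the inner product.\<close>
  moreover have "b = a + c - 2 * (\<integral>w. (X w - ?Y w) \<bullet> (Z w - ?Y w) \<partial>M)"
  proof -
    note s = sq_integrable_diff[OF Xs Ys] sq_integrable_diff[OF Ys Z(1)] sq_integrable_diff[OF Z(1) Ys]
    have "b = (\<integral>w. (norm (X w - ?Y w))\<^sup>2 + (norm (?Y w - Z w))\<^sup>2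
        - 2 * ((X w - ?Y w) \<bullet> (Z w - ?Y w)) \<partial>M)"
      unfolding b_def L2_norm_power2
      by (intro Bochner_Integration.integral_cong refl)
         (simp add: power2_norm_eq_inner inner_diff_left inner_diff_right inner_commute algebra_simps)
    then show ?thesis
      using s sq_integrable_inner[OF s(1,3)] by (simp add: a_def c_def L2_norm_power2 sq_integrable_def)
  qed
  ultimately show ?thesis by simp
qed

text \<open>Another minimizer \<eta> need not come with a map. In a coupling of \<mu> and \<eta> of
  nearly minimal cost, the midpoint of T X and the second coordinate has an admissible law, so the
  parallelogram law makes the two close, and \<open>W2\<close> between the minimizers is 0.\<close>

lemma I2_eq_distr:
  assumes T: "is_projection_map \<mu> \<nu> T" and \<mu>: "\<mu> \<in> P2" and \<nu>: "\<nu> \<in> P2"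
  shows "I2 \<mu> \<nu> = distr \<mu> borel T"
  unfolding I2_def
proof (rule the_equality)
  note [measurable] = is_projection_map_D(2)[OF T \<mu>]
  note TD = is_projection_map_D[OF T \<mu>]
  show "is_arg_min (W2 \<mu>) (\<lambda>\<eta>. \<eta> \<in> P2 \<and> \<eta> \<le>\<^sub>c\<^sub>x \<nu>) (distr \<mu> borel T)"
    using TD by (fastforce simp: is_arg_min_def)
  fix \<eta> assume "is_arg_min (W2 \<mu>) (\<lambda>\<eta>. \<eta> \<in> P2 \<and> \<eta> \<le>\<^sub>c\<^sub>x \<nu>) \<eta>"
  then have \<eta>: "\<eta> \<in> P2" "\<eta> \<le>\<^sub>c\<^sub>x \<nu>" and "\<not> W2 \<mu> (distr \<mu> borel T) < W2 \<mu> \<eta>"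
    using TD by (auto simp: is_arg_min_def)
  then have W: "W2 \<mu> \<eta> = L2_norm \<mu> (\<lambda>x. x - T x)"
    using TD(5,6) by fastforce
  define D where "D = L2_norm \<mu> (\<lambda>x. x - T x)"
  have D0: "0 \<le> D" by (simp add: D_def L2_norm_nonneg)
  have "(W2 (distr \<mu> borel T) \<eta>)\<^sup>2 \<le> 0 + e" if e: "e > 0" for e
  proof -
    obtain d where d: "d > 0" "4 * (2 * D * d + d\<^sup>2) < e" using small_quadratic[OF e D0] .
    obtain \<pi> where \<pi>: "\<pi> \<in> couplings \<mu> \<eta>" "L2_norm \<pi> (\<lambda>w. fst w - snd w) < D + d"
      using W2_near_optimal[OF \<mu> \<eta>(1) d(1)] unfolding W D_def .
    interpret \<pi>: prob_space \<pi> using \<pi>(1) by (rule couplings_D)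
    note c = couplings_D[OF \<pi>(1)]
    note [measurable] = c(3,4)
    note sq = couplings_sq_integrable[OF \<pi>(1) \<mu> \<eta>(1)]
    let ?Y = "\<lambda>w. T (fst w)"
    have Ys: "sq_integrable \<pi> ?Y"
      using TD(1) unfolding c(5)[symmetric] by (simp add: sq_integrable_distr)
    have DT: "D = L2_norm \<pi> (\<lambda>w. fst w - ?Y w)"
      unfolding D_def c(5)[symmetric] by (simp add: L2_norm_distr)
    have Y_law: "distr \<pi> borel ?Y = distr \<mu> borel T"
      unfolding c(5)[symmetric] by (simp add: distr_distr comp_def)
    let ?V = "\<lambda>w. (1 - 1/2) *\<^sub>R ?Y w + (1/2) *\<^sub>R snd w"
    have V: "sq_integrable \<pi> ?V" by (intro sq_integrable_add sq_integrable_scaleR Ys sq)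
    have "distr \<pi> borel ?V \<le>\<^sub>c\<^sub>x \<nu>"
      using TD(4) \<eta>(2) by (intro \<pi>.convex_order_interpolate Ys sq \<nu>) (auto simp: Y_law c)
    then have "D \<le> W2 \<mu> (distr \<pi> borel ?V)"
      unfolding D_def by (intro TD(5) \<pi>.distr_in_P2 V)
    also have "\<dots> \<le> L2_norm \<pi> (\<lambda>w. fst w - ?V w)"
      using \<pi>.W2_distr_le[OF sq(1) V] by (simp add: c)
    finally have "(L2_norm \<pi> (\<lambda>w. ?Y w - snd w))\<^sup>2 \<le> 4 * (2 * D * d + d\<^sup>2)"
      using \<pi>(2) d(1) by (intro L2_norm_midpoint[OF sq(1) Ys sq(2) _ D0]) (auto simp: DT)
    moreover have "(W2 (distr \<mu> borel T) \<eta>)\<^sup>2 \<le> (L2_norm \<pi> (\<lambda>w. ?Y w - snd w))\<^sup>2"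
      using \<pi>.W2_distr_le[OF Ys sq(2)] by (intro power_mono W2_nonneg) (simp add: Y_law c)
    ultimately show ?thesis using d(2) by simp
  qed
  then have "(W2 (distr \<mu> borel T) \<eta>)\<^sup>2 \<le> 0" by (rule field_le_epsilon)
  then have "W2 (distr \<mu> borel T) \<eta> = 0" by simp
  then show "\<eta> = distr \<mu> borel T"
    using W2_eq_0_imp_eq[OF TD(3) \<eta>(1)] by simp
qed

text \<open>The two obtuse angle conditions add up to |B|^2 <= <A, B> for A = X - X' and B = T X -
  T' X'. As B integrates to 0, A may be replaced by A - m with m the mean of A, and |A - m|^2 =
  |A|^2 - |m|^2.\<close>

lemma projection_nonexpansive:
  assumes \<pi>: "\<pi> \<in> couplings \<mu> \<mu>'" and \<mu>: "\<mu> \<in> P2" and \<mu>': "\<mu>' \<in> P2" and \<nu>: "\<nu> \<in> P2"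
    and T: "is_projection_map \<mu> \<nu> T" and T': "is_projection_map \<mu>' \<nu> T'"
  shows "(L2_norm \<pi> (\<lambda>w. T (fst w) - T' (snd w)))\<^sup>2
    \<le> (L2_norm \<pi> (\<lambda>w. fst w - snd w))\<^sup>2 - (norm (mean \<mu> - mean \<mu>'))\<^sup>2"
proof -
  interpret \<pi>: prob_space \<pi> using \<pi> by (rule couplings_D)
  note c = couplings_D[OF \<pi>]
  note [measurable] = c(3,4) is_projection_map_D(2)[OF T \<mu>] is_projection_map_D(2)[OF T' \<mu>']
  note sq = couplings_sq_integrable[OF \<pi> \<mu> \<mu>']
  let ?Y = "\<lambda>w. T (fst w)" and ?Y' = "\<lambda>w. T' (snd w)"
  have Y: "sq_integrable \<pi> ?Y"
    using is_projection_map_D(1)[OF T \<mu>] unfolding c(5)[symmetric] by (simp add: sq_integrable_distr)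
  have Y': "sq_integrable \<pi> ?Y'"
    using is_projection_map_D(1)[OF T' \<mu>'] unfolding c(6)[symmetric] by (simp add: sq_integrable_distr)
  have Yl: "distr \<pi> borel ?Y \<le>\<^sub>c\<^sub>x \<nu>"
    using is_projection_map_D(4)[OF T \<mu>] unfolding c(5)[symmetric] by (simp add: distr_distr comp_def)
  have Yl': "distr \<pi> borel ?Y' \<le>\<^sub>c\<^sub>x \<nu>"
    using is_projection_map_D(4)[OF T' \<mu>'] unfolding c(6)[symmetric] by (simp add: distr_distr comp_def)
  have "mean (distr \<pi> borel ?Y) = mean (distr \<pi> borel ?Y')"
    using convex_order_mean[OF Yl \<pi>.distr_in_P2[OF Y] \<nu>] convex_order_mean[OF Yl' \<pi>.distr_in_P2[OF Y'] \<nu>]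
    by simp
  then have means: "(\<integral>w. ?Y w \<partial>\<pi>) = (\<integral>w. ?Y' w \<partial>\<pi>)" by (simp add: mean_distr)
  define m where "m = mean \<mu> - mean \<mu>'"
  have m: "m = (\<integral>w. fst w - snd w \<partial>\<pi>)"
  proof -
    have "m = (\<integral>w. fst w \<partial>\<pi>) - (\<integral>w. snd w \<partial>\<pi>)"
      unfolding m_def c(5,6)[symmetric] by (simp add: mean_distr)
    then show ?thesis
      using sq by (simp add: \<pi>.sq_integrable_integrable)
  qed
  let ?A = "\<lambda>w. fst w - snd w" and ?B = "\<lambda>w. ?Y w - ?Y' w"
  have A: "sq_integrable \<pi> ?A" by (intro sq_integrable_diff sq)
  have A': "sq_integrable \<pi> (\<lambda>w. ?A w - m)" by (intro sq_integrable_diff sq \<pi>.sq_integrable_const)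
  have B: "sq_integrable \<pi> ?B" by (intro sq_integrable_diff Y Y')
  have iB: "integrable \<pi> ?B" using B by (rule \<pi>.sq_integrable_integrable)
  have o1: "(\<integral>w. (fst w - ?Y w) \<bullet> (?Y' w - ?Y w) \<partial>\<pi>) \<le> 0"
    by (rule \<pi>.projection_map_obtuse[OF T \<mu> \<nu> c(3,5) Y' Yl'])
  have o2: "(\<integral>w. (snd w - ?Y' w) \<bullet> (?Y w - ?Y' w) \<partial>\<pi>) \<le> 0"
    by (rule \<pi>.projection_map_obtuse[OF T' \<mu>' \<nu> c(4,6) Y Yl])
  have i: "integrable \<pi> (\<lambda>w. (fst w - ?Y w) \<bullet> (?Y' w - ?Y w))"
    "integrable \<pi> (\<lambda>w. (snd w - ?Y' w) \<bullet> (?Y w - ?Y' w))"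
    by (intro sq_integrable_inner sq_integrable_diff sq Y Y')+
  have "(L2_norm \<pi> ?B)\<^sup>2 = (\<integral>w. (?A w - m) \<bullet> ?B w + m \<bullet> ?B w
      + (fst w - ?Y w) \<bullet> (?Y' w - ?Y w) + (snd w - ?Y' w) \<bullet> (?Y w - ?Y' w) \<partial>\<pi>)"
    unfolding L2_norm_power2
    by (intro Bochner_Integration.integral_cong refl)
       (simp add: power2_norm_eq_inner inner_diff_left inner_diff_right inner_commute algebra_simps)
  also have "\<dots> = (\<integral>w. (?A w - m) \<bullet> ?B w \<partial>\<pi>) + m \<bullet> (\<integral>w. ?B w \<partial>\<pi>)
      + (\<integral>w. (fst w - ?Y w) \<bullet> (?Y' w - ?Y w) \<partial>\<pi>) + (\<integral>w. (snd w - ?Y' w) \<bullet> (?Y w - ?Y' w) \<partial>\<pi>)"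
    using i sq_integrable_inner[OF A' B] iB
    by (simp add: Bochner_Integration.integral_add Bochner_Integration.integrable_add
        del: Bochner_Integration.integral_diff)
  also have "(\<integral>w. ?B w \<partial>\<pi>) = 0"
    using means Y Y' by (simp add: \<pi>.sq_integrable_integrable)
  finally have "(L2_norm \<pi> ?B)\<^sup>2 \<le> (\<integral>w. (?A w - m) \<bullet> ?B w \<partial>\<pi>)"
    using o1 o2 by simp
  also have "\<dots> \<le> L2_norm \<pi> (\<lambda>w. ?A w - m) * L2_norm \<pi> ?B"
    by (rule L2_inner_le[OF A' B])
  finally have "L2_norm \<pi> ?B \<le> L2_norm \<pi> (\<lambda>w. ?A w - m)"
    using L2_norm_nonneg[of \<pi> ?B] L2_norm_nonneg[of \<pi> "\<lambda>w. ?A w - m"]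
    by (cases "L2_norm \<pi> ?B = 0") (auto simp: power2_eq_square)
  then have "(L2_norm \<pi> ?B)\<^sup>2 \<le> (L2_norm \<pi> (\<lambda>w. ?A w - m))\<^sup>2"
    by (intro power_mono L2_norm_nonneg)
  also have "\<dots> = (L2_norm \<pi> ?A)\<^sup>2 - (norm m)\<^sup>2"
    unfolding \<pi>.L2_norm_diff_const_power2[OF A] m[symmetric] by (simp add: power2_norm_eq_inner)
  finally show ?thesis by (simp add: m_def)
qed

subsection \<open>Duality for finitely supported plans\<close>

lemma compact_PiE_UNIV:
  fixes S :: "'i \<Rightarrow> 'b::topological_space set"
  assumes "\<And>i. compact (S i)"
  shows "compact (PiE UNIV S)"
  using assms compactin_PiE[of "\<lambda>_. euclidean" UNIV S]
  by (auto simp: euclidean_product_topology)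

text \<open>Plans are total functions on index types that may be infinite; prescribing 0 off
  \<open>I \<times> J\<close> makes the set compact in the product topology.\<close>

definition transport_plans ::
    "'i set \<Rightarrow> 'j set \<Rightarrow> ('i \<Rightarrow> real) \<Rightarrow> ('j \<Rightarrow> real) \<Rightarrow> ('i \<times> 'j \<Rightarrow> real) set" where
  "transport_plans I J p q = {\<gamma>. (\<forall>z. 0 \<le> \<gamma> z) \<and> (\<forall>z. z \<notin> I \<times> J \<longrightarrow> \<gamma> z = 0) \<and>
     (\<forall>i\<in>I. (\<Sum>j\<in>J. \<gamma> (i, j)) = p i) \<and> (\<forall>j\<in>J. (\<Sum>i\<in>I. \<gamma> (i, j)) = q j)}"

text \<open>A closed subset of a product of compact sets: a nonnegative entry is at most its row sum
  \<open>p i\<close>, and off the grid the factor is {0}.\<close>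

lemma compact_transport_plans:
  fixes p :: "'i \<Rightarrow> real" and q :: "'j \<Rightarrow> real"
  assumes I: "finite I" and J: "finite J"
  shows "compact (transport_plans I J p q)"
proof -
  have c: "continuous_on UNIV (\<lambda>\<gamma> :: 'i \<times> 'j \<Rightarrow> real. \<gamma> z)" for z
    by (rule continuous_on_product_coordinates)
  let ?B = "\<lambda>z. if z \<in> I \<times> J then {0..p (fst z)} else {0}"
  let ?R = "\<Inter>i\<in>I. {\<gamma>. (\<Sum>j\<in>J. \<gamma> (i, j)) = p i}"
  let ?C = "\<Inter>j\<in>J. {\<gamma>. (\<Sum>i\<in>I. \<gamma> (i, j)) = q j}"
  have "compact (PiE UNIV ?B)" by (rule compact_PiE_UNIV) auto
  moreover have "closed ?R" "closed ?C"
    by (intro closed_INT ballI closed_Collect_eq continuous_on_sum c continuous_on_const)+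
  ultimately have "compact (PiE UNIV ?B \<inter> (?R \<inter> ?C))"
    by (intro compact_Int_closed closed_Int)
  moreover have "transport_plans I J p q = PiE UNIV ?B \<inter> (?R \<inter> ?C)"
  proof (intro set_eqI iffI)
    fix \<gamma> assume \<gamma>: "\<gamma> \<in> transport_plans I J p q"
    have "\<gamma> (i, j) \<le> p i" if "i \<in> I" "j \<in> J" for i j
    proof -
      have "\<gamma> (i, j) \<le> (\<Sum>j\<in>J. \<gamma> (i, j))"
        using \<gamma> J that by (intro member_le_sum) (auto simp: transport_plans_def)
      then show ?thesis using \<gamma> that by (simp add: transport_plans_def)
    qed
    then show "\<gamma> \<in> PiE UNIV ?B \<inter> (?R \<inter> ?C)"
      using \<gamma> by (auto simp: transport_plans_def)
  next
    fix \<gamma> assume \<gamma>: "\<gamma> \<in> PiE UNIV ?B \<inter> (?R \<inter> ?C)"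
    have B: "\<gamma> z \<in> ?B z" for z by (rule PiE_mem[OF IntD1[OF \<gamma>] UNIV_I])
    have "0 \<le> \<gamma> z" for z using B[of z] by (auto split: if_splits)
    moreover have "\<gamma> z = 0" if "z \<notin> I \<times> J" for z using B[of z] that by auto
    ultimately show "\<gamma> \<in> transport_plans I J p q"
      using \<gamma> by (auto simp: transport_plans_def)
  qed
  ultimately show ?thesis by simp
qed

text \<open>The conditional mean of \<open>y\<close> given the row \<open>i\<close> under the
  plan.\<close>

definition barycentre ::
    "'j set \<Rightarrow> ('i \<Rightarrow> real) \<Rightarrow> ('j \<Rightarrow> 'a::euclidean_space) \<Rightarrow> ('i \<times> 'j \<Rightarrow> real) \<Rightarrow> 'i \<Rightarrow> 'a" where
  "barycentre J p y \<gamma> i = (1 / p i) *\<^sub>R (\<Sum>j\<in>J. \<gamma> (i, j) *\<^sub>R y j)"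

text \<open>The barycentric cost, the sum of p i |x i - b i|^2, is quadratic in the plan. At a
  minimizer its first-order condition is that of a linear transport problem with gain (x i - b i) .
  y j, tested on perturbations that keep the marginals and remove mass only where there is
  some.\<close>

lemma optimal_barycentric_plan:
  fixes x :: "'i \<Rightarrow> 'a::euclidean_space" and y :: "'j \<Rightarrow> 'a"
  assumes I: "finite I" and J: "finite J"
    and p: "\<And>i. i \<in> I \<Longrightarrow> 0 < p i" and q: "\<And>j. j \<in> J \<Longrightarrow> 0 \<le> q j"
    and p1: "sum p I = 1" and q1: "sum q J = 1"
  obtains \<gamma> where "\<gamma> \<in> transport_plans I J p q"
    "\<And>D. (\<And>i. i \<in> I \<Longrightarrow> (\<Sum>j\<in>J. D (i, j)) = 0) \<Longrightarrow> (\<And>j. j \<in> J \<Longrightarrow> (\<Sum>i\<in>I. D (i, j)) = 0) \<Longrightarrow>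
      (\<And>z. z \<in> I \<times> J \<Longrightarrow> D z < 0 \<Longrightarrow> 0 < \<gamma> z) \<Longrightarrow>
      (\<Sum>i\<in>I. \<Sum>j\<in>J. D (i, j) * ((x i - barycentre J p y \<gamma> i) \<bullet> y j)) \<le> 0"
proof -
  let ?F = "\<lambda>\<gamma>. \<Sum>i\<in>I. p i * (norm (x i - barycentre J p y \<gamma> i))\<^sup>2"
  have c: "continuous_on UNIV (\<lambda>\<gamma> :: 'i \<times> 'j \<Rightarrow> real. \<gamma> z)" for z
    by (rule continuous_on_product_coordinates)
  have "continuous_on UNIV ?F"
    unfolding barycentre_def by (intro continuous_intros c)
  then have cont: "continuous_on (transport_plans I J p q) ?F"
    by (rule continuous_on_subset) simp
  \<comment> \<open>The product plan shows that the constraint set is nonempty.\<close>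
  let ?\<gamma>0 = "\<lambda>z. if z \<in> I \<times> J then p (fst z) * q (snd z) else 0"
  have "?\<gamma>0 \<in> transport_plans I J p q"
    using p q p1 q1
    by (auto simp: transport_plans_def less_imp_le simp flip: sum_distrib_left sum_distrib_right)
  then have "transport_plans I J p q \<noteq> {}" by blast
  from continuous_attains_inf[OF compact_transport_plans[OF I J] this cont]
  obtain \<gamma> where \<gamma>: "\<gamma> \<in> transport_plans I J p q"
    and min: "\<And>\<gamma>'. \<gamma>' \<in> transport_plans I J p q \<Longrightarrow> ?F \<gamma> \<le> ?F \<gamma>'" by blast
  have "(\<Sum>i\<in>I. \<Sum>j\<in>J. D (i, j) * ((x i - barycentre J p y \<gamma> i) \<bullet> y j)) \<le> 0"
    if rows: "\<And>i. i \<in> I \<Longrightarrow> (\<Sum>j\<in>J. D (i, j)) = 0"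
    and cols: "\<And>j. j \<in> J \<Longrightarrow> (\<Sum>i\<in>I. D (i, j)) = 0"
    and neg: "\<And>z. z \<in> I \<times> J \<Longrightarrow> D z < 0 \<Longrightarrow> 0 < \<gamma> z" for D
  proof -
    let ?u = "\<lambda>i. x i - barycentre J p y \<gamma> i"
    define d where "d i = (\<Sum>j\<in>J. D (i, j) *\<^sub>R y j)" for i
    define L where "L = (\<Sum>i\<in>I. ?u i \<bullet> d i)"
    define Q where "Q = (\<Sum>i\<in>I. (norm (d i))\<^sup>2 / p i)"
    \<comment> \<open>An entry can turn negative only where \<open>D\<close> is negative. There
      \<gamma> is positive, and the grid is finite, so all small t > 0 are admissible.\<close>
    let ?\<gamma> = "\<lambda>t z. if z \<in> I \<times> J then \<gamma> z + t * D z else 0"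
    have "\<forall>\<^sub>F t in at_right 0. 0 \<le> \<gamma> z + t * D z" if z: "z \<in> I \<times> J" for z
    proof (cases "D z < 0")
      case True
      have "((\<lambda>t. \<gamma> z + t * D z) \<longlongrightarrow> \<gamma> z + 0 * D z) (at_right 0)"
        by (intro tendsto_intros)
      then have "\<forall>\<^sub>F t in at_right 0. 0 < \<gamma> z + t * D z"
        using neg[OF z True] by (intro order_tendstoD(1)) auto
      then show ?thesis by eventually_elim simp
    next
      case False
      have "0 \<le> \<gamma> z" using \<gamma> unfolding transport_plans_def by blast
      with False show ?thesis by (intro eventually_at_rightI[of 0 1]) auto
    qed
    then have "\<forall>\<^sub>F t in at_right 0. \<forall>z\<in>I \<times> J. 0 \<le> \<gamma> z + t * D z"
      using I J by (simp add: eventually_ball_finite_distrib)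
    moreover have "\<forall>\<^sub>F t::real in at_right 0. 0 < t"
      by (intro eventually_at_rightI[of 0 1]) auto
    ultimately have "\<forall>\<^sub>F t in at_right 0. L \<le> t * Q / 2"
    proof eventually_elim
      case (elim t)
      have "?\<gamma> t \<in> transport_plans I J p q"
        using \<gamma> elim(1) rows cols
        by (auto simp: transport_plans_def sum.distrib simp flip: sum_distrib_left)
      then have "?F \<gamma> \<le> ?F (?\<gamma> t)" by (rule min)
      also have "?F (?\<gamma> t) = (\<Sum>i\<in>I. p i * (norm (?u i))\<^sup>2 - 2 * t * (?u i \<bullet> d i) + t\<^sup>2 * ((norm (d i))\<^sup>2 / p i))"
      proof (rule sum.cong[OF refl])
        fix i assume i: "i \<in> I"
        have b: "barycentre J p y (?\<gamma> t) i = barycentre J p y \<gamma> i + (t / p i) *\<^sub>R d i"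
          using i by (simp add: barycentre_def d_def scaleR_add_left sum.distrib scaleR_sum_right
              scaleR_add_right)
        have "(norm (?u i - (t / p i) *\<^sub>R d i))\<^sup>2
            = (norm (?u i))\<^sup>2 - 2 * (t / p i) * (?u i \<bullet> d i) + (t / p i)\<^sup>2 * (norm (d i))\<^sup>2"
          unfolding power2_norm_eq_inner power2_eq_square[of "t / p i"]
          by (simp add: inner_diff_left inner_diff_right inner_commute algebra_simps)
        then show "p i * (norm (x i - barycentre J p y (?\<gamma> t) i))\<^sup>2
            = p i * (norm (?u i))\<^sup>2 - 2 * t * (?u i \<bullet> d i) + t\<^sup>2 * ((norm (d i))\<^sup>2 / p i)"
          using p[OF i] unfolding b diff_diff_eq[symmetric]
          by (simp add: field_simps power2_eq_square)
      qed
      \<comment> \<open>Minimality forces 2 t L <= t^2 Q; dividing by t and letting t tend to 0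
        leaves L <= 0.\<close>
      also have "\<dots> = ?F \<gamma> - 2 * t * L + t\<^sup>2 * Q"
        by (simp add: sum.distrib sum_subtractf L_def Q_def sum_distrib_left)
      finally have "t * (2 * L) \<le> t * (t * Q)" by (simp add: power2_eq_square algebra_simps)
      then show ?case using elim(2) by simp
    qed
    moreover have "((\<lambda>t. t * Q / 2) \<longlongrightarrow> 0 * Q / 2) (at_right 0)"
      by (intro tendsto_intros) auto
    ultimately have "L \<le> 0 * Q / 2" by (intro tendsto_lowerbound) auto
    then show ?thesis
      by (simp add: L_def d_def inner_sum_right)
  qed
  with \<gamma> that show ?thesis by blast
qed

text \<open>Complementary slackness for the transport problem.  The potential of \<open>k\<close> is the best gain
  over all admissible perturbations carrying a unit of mass from a base point \<open>o'\<close> to \<open>k\<close>; optimality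
  of \<open>\<gamma>\<close> says that perturbations preserving both marginals have no gain, which bounds the supremum.\<close>

lemma transport_potential:
  fixes \<gamma> a :: "'i \<times> 'j \<Rightarrow> real"
  assumes I: "finite I" and J: "finite J"
    and ex: "\<And>i. i \<in> I \<Longrightarrow> \<exists>j\<in>J. 0 < \<gamma> (i, j)"
    and opt: "\<And>D. (\<And>i. i \<in> I \<Longrightarrow> (\<Sum>j\<in>J. D (i, j)) = 0) \<Longrightarrow> (\<And>j. j \<in> J \<Longrightarrow> (\<Sum>i\<in>I. D (i, j)) = 0) \<Longrightarrow>
      (\<And>z. z \<in> I \<times> J \<Longrightarrow> D z < 0 \<Longrightarrow> 0 < \<gamma> z) \<Longrightarrow> (\<Sum>i\<in>I. \<Sum>j\<in>J. D (i, j) * a (i, j)) \<le> 0"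
  obtains c where "\<And>i j k. i \<in> I \<Longrightarrow> j \<in> J \<Longrightarrow> k \<in> I \<Longrightarrow> 0 < \<gamma> (i, j) \<Longrightarrow> a (k, j) - c k \<le> a (i, j) - c i"
proof (cases "I = {}")
  case True
  then show ?thesis using that by blast
next
  case False
  then obtain o' where o': "o' \<in> I" by blast
  define val where "val D = (\<Sum>i\<in>I. \<Sum>j\<in>J. D (i, j) * a (i, j))" for D :: "'i \<times> 'j \<Rightarrow> real"
  define adm where "adm k D \<longleftrightarrow> (\<forall>j\<in>J. (\<Sum>i\<in>I. D (i, j)) = 0) \<and>
      (\<forall>z\<in>I \<times> J. D z < 0 \<longrightarrow> 0 < \<gamma> z) \<and>
      (\<forall>i\<in>I. (\<Sum>j\<in>J. D (i, j)) = of_bool (i = k) - of_bool (i = o'))" for k and D :: "'i \<times> 'j \<Rightarrow> real"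
  \<comment> \<open>One unit of mass moves within column \<open>j\<close> from row \<open>i\<close>
    to row \<open>k\<close>: the column sums stay, and the only entry that is lowered is (i, j),
    where \<gamma> will be positive.\<close>
  define move where "move k i j D = (\<lambda>z. D z + of_bool (z = (k, j)) - of_bool (z = (i, j)))"
    for k i :: 'i and j :: 'j and D :: "'i \<times> 'j \<Rightarrow> real"
  have row: "(\<Sum>j'\<in>J. of_bool ((i', j') = (i, j)) :: real) = of_bool (i' = i)" if "j \<in> J" for i i' j
    using that J by (cases "i' = i") (auto simp: of_bool_def sum.delta)
  have col: "(\<Sum>i'\<in>I. of_bool ((i', j') = (i, j)) :: real) = of_bool (j' = j)" if "i \<in> I" for i j j'
    using that I by (cases "j' = j") (auto simp: of_bool_def sum.delta)
  have val_unit: "(\<Sum>i'\<in>I. \<Sum>j'\<in>J. of_bool ((i', j') = (i, j)) * a (i', j')) = a (i, j)"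
    if "i \<in> I" "j \<in> J" for i j
  proof -
    have "(\<Sum>j'\<in>J. of_bool ((i', j') = (i, j)) * a (i', j')) = (if i' = i then a (i, j) else 0)" for i'
      using that J by (cases "i' = i") (auto simp: of_bool_def if_distrib[of "\<lambda>b. b * _"] sum.delta cong: if_cong)
    then show ?thesis using that I by (simp add: sum.delta)
  qed
  have adm_move: "adm k (move k i j D)" and val_move: "val (move k i j D) = val D + a (k, j) - a (i, j)"
    if "adm i D" "i \<in> I" "k \<in> I" "j \<in> J" "0 < \<gamma> (i, j)" for i j k D
  proof -
    show "adm k (move k i j D)"
      unfolding adm_def
    proof (intro conjI ballI impI)
      fix j' assume "j' \<in> J"
      then show "(\<Sum>i'\<in>I. move k i j D (i', j')) = 0"
        using that by (simp only: move_def sum.distrib sum_subtractf col) (simp add: adm_def)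
    next
      fix i' assume "i' \<in> I"
      then show "(\<Sum>j'\<in>J. move k i j D (i', j')) = of_bool (i' = k) - of_bool (i' = o')"
        using that by (simp only: move_def sum.distrib sum_subtractf row) (simp add: adm_def)
    next
      fix z assume "z \<in> I \<times> J" "move k i j D z < 0"
      then show "0 < \<gamma> z"
        using that by (cases "z = (i, j)") (auto simp: move_def adm_def of_bool_def split: if_splits)
    qed
    show "val (move k i j D) = val D + a (k, j) - a (i, j)"
      using that by (simp only: val_def move_def distrib_right left_diff_distrib sum.distrib
          sum_subtractf val_unit)
  qed
  define c where "c k = Sup (val ` {D. adm k D})" for k
  have adm0: "adm o' (\<lambda>_. 0)" by (simp add: adm_def)
  have ne: "{D. adm k D} \<noteq> {}" if k: "k \<in> I" for k
  proof -
    obtain j where j: "j \<in> J" "0 < \<gamma> (o', j)" using ex[OF o'] by blast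
    from adm_move[OF adm0 o' k j] show ?thesis by blast
  qed
  \<comment> \<open>Carrying the unit back from \<open>k\<close> to the base row closes the
    perturbation up, so optimality applies. The gain of the way back is fixed, which bounds that of
    the way out.\<close>
  have bdd: "bdd_above (val ` {D. adm k D})" if k: "k \<in> I" for k
  proof -
    obtain j where j: "j \<in> J" "0 < \<gamma> (k, j)" using ex[OF k] by blast
    have "val D \<le> a (k, j) - a (o', j)" if "adm k D" for D
    proof -
      have "adm o' (move o' k j D)" by (rule adm_move[OF that k o' j])
      then have "val (move o' k j D) \<le> 0"
        unfolding val_def by (intro opt) (auto simp: adm_def)
      then show ?thesis using val_move[OF that k o' j] by simp
    qed
    then show ?thesis by (intro bdd_aboveI2) auto
  qed
  \<comment> \<open>A perturbation that ends at \<open>i\<close> extends by one move to one that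
    ends at \<open>k\<close>; taking the supremum over the former gives c i + a (k, j) - a (i, j) <=
    c k.\<close>
  have "a (k, j) - c k \<le> a (i, j) - c i"
    if i: "i \<in> I" and j: "j \<in> J" and k: "k \<in> I" and pos: "0 < \<gamma> (i, j)" for i j k
  proof -
    have "val D \<le> c k - a (k, j) + a (i, j)" if D: "adm i D" for D
    proof -
      have "val (move k i j D) \<le> c k"
        unfolding c_def using adm_move[OF D i k j pos] by (intro cSup_upper bdd[OF k]) auto
      then show ?thesis using val_move[OF D i k j pos] by simp
    qed
    then have "c i \<le> c k - a (k, j) + a (i, j)"
      unfolding c_def[of i] using ne[OF i] by (intro cSup_least) auto
    then show ?thesis by simp
  qed
  then show ?thesis by (rule that)
qed

section \<open>Maxima of affine functions as dual potentials\<close>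

lemma convex_on_Max_affine:
  fixes u :: "'i \<Rightarrow> 'a::real_inner"
  assumes "finite I" "I \<noteq> {}"
  shows "convex_on UNIV (\<lambda>z. MAX i\<in>I. u i \<bullet> z - d i)"
proof (rule convex_onI)
  fix t :: real and x y :: 'a assume t: "0 < t" "t < 1"
  show "(MAX i\<in>I. u i \<bullet> ((1 - t) *\<^sub>R x + t *\<^sub>R y) - d i)
      \<le> (1 - t) * (MAX i\<in>I. u i \<bullet> x - d i) + t * (MAX i\<in>I. u i \<bullet> y - d i)"
  proof (rule Max.boundedI)
    fix a assume "a \<in> (\<lambda>i. u i \<bullet> ((1 - t) *\<^sub>R x + t *\<^sub>R y) - d i) ` I"
    then obtain i where i: "i \<in> I" "a = u i \<bullet> ((1 - t) *\<^sub>R x + t *\<^sub>R y) - d i" by blast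
    then have "a = (1 - t) * (u i \<bullet> x - d i) + t * (u i \<bullet> y - d i)"
      by (simp add: inner_add_right algebra_simps)
    also have "\<dots> \<le> (1 - t) * (MAX i\<in>I. u i \<bullet> x - d i) + t * (MAX i\<in>I. u i \<bullet> y - d i)"
      using t i assms by (intro add_mono mult_left_mono Max_ge) auto
    finally show "a \<le> \<dots>" .
  qed (use assms in auto)
qed simp

text \<open>A maximum is one of its terms, hence bounded by the sum of all absolute values.\<close>

lemma (in prob_space) integrable_Max_affine:
  fixes u :: "'i \<Rightarrow> 'v::euclidean_space"
  assumes I: "finite I" "I \<noteq> {}" and Z: "integrable M Z"
  shows "integrable M (\<lambda>w. MAX i\<in>I. u i \<bullet> Z w - d i)"
proof (rule Bochner_Integration.integrable_bound[where f="\<lambda>w. \<Sum>i\<in>I. \<bar>u i \<bullet> Z w - d i\<bar>"])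
  have "(\<lambda>z. MAX i\<in>I. u i \<bullet> z - d i) \<in> borel_measurable borel"
    using convex_on_Max_affine[OF I] by (rule convex_on_UNIV_borel)
  from measurable_compose[OF borel_measurable_integrable[OF Z] this]
  show "(\<lambda>w. MAX i\<in>I. u i \<bullet> Z w - d i) \<in> borel_measurable M" .
  show "integrable M (\<lambda>w. \<Sum>i\<in>I. \<bar>u i \<bullet> Z w - d i\<bar>)"
    using Z by (intro Bochner_Integration.integrable_sum integrable_abs Bochner_Integration.integrable_diff) auto
  show "AE w in M. norm (MAX i\<in>I. u i \<bullet> Z w - d i) \<le> norm (\<Sum>i\<in>I. \<bar>u i \<bullet> Z w - d i\<bar>)"
  proof (rule AE_I2)
    fix w
    have "(MAX i\<in>I. u i \<bullet> Z w - d i) \<in> (\<lambda>i. u i \<bullet> Z w - d i) ` I"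
      using I by (intro Max_in) auto
    then obtain i where i: "i \<in> I" "(MAX i\<in>I. u i \<bullet> Z w - d i) = u i \<bullet> Z w - d i" by blast
    have "\<bar>u i \<bullet> Z w - d i\<bar> \<le> (\<Sum>i\<in>I. \<bar>u i \<bullet> Z w - d i\<bar>)"
      using i I by (intro member_le_sum) auto
    with i show "norm (MAX i\<in>I. u i \<bullet> Z w - d i) \<le> norm (\<Sum>i\<in>I. \<bar>u i \<bullet> Z w - d i\<bar>)"
      by simp
  qed
qed

text \<open>Finite form of the bound below: with \<open>\<phi> = max\<^sub>i (u\<^sub>i \<bullet> y - c\<^sub>i)\<close> and
  \<open>h = max\<^sub>i (u\<^sub>i \<bullet> x - c\<^sub>i - |u\<^sub>i|\<^sup>2 / 2)\<close>, completing the square yields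
  \<open>h x - \<phi> y \<le> |x - y|\<^sup>2 / 2\<close>, while complementary slackness evaluates both at the optimal plan.\<close>

lemma barycentric_duality:
  fixes x :: "'i \<Rightarrow> 'a::euclidean_space" and y :: "'j \<Rightarrow> 'a"
  assumes I: "finite I" and J: "finite J"
    and p: "\<And>i. i \<in> I \<Longrightarrow> 0 < p i" and q: "\<And>j. j \<in> J \<Longrightarrow> 0 \<le> q j"
    and p1: "sum p I = 1" and q1: "sum q J = 1"
  obtains \<gamma> h \<phi> where "\<gamma> \<in> transport_plans I J p q"
    "convex_on UNIV h"
    "\<And>M :: 'a measure. M \<in> P2 \<Longrightarrow> integrable M h"
    "\<And>a b. h a - \<phi> b \<le> (norm (a - b))\<^sup>2 / 2"
    "(\<Sum>i\<in>I. p i * (norm (x i - barycentre J p y \<gamma> i))\<^sup>2) / 2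
      \<le> (\<Sum>i\<in>I. p i * h (x i)) - (\<Sum>j\<in>J. q j * \<phi> (y j))"
proof -
  have I_ne: "I \<noteq> {}" using p1 by auto
  obtain \<gamma> where \<gamma>: "\<gamma> \<in> transport_plans I J p q"
    and opt: "\<And>D. (\<And>i. i \<in> I \<Longrightarrow> (\<Sum>j\<in>J. D (i, j)) = 0) \<Longrightarrow> (\<And>j. j \<in> J \<Longrightarrow> (\<Sum>i\<in>I. D (i, j)) = 0) \<Longrightarrow>
      (\<And>z. z \<in> I \<times> J \<Longrightarrow> D z < 0 \<Longrightarrow> 0 < \<gamma> z) \<Longrightarrow>
      (\<Sum>i\<in>I. \<Sum>j\<in>J. D (i, j) * ((x i - barycentre J p y \<gamma> i) \<bullet> y j)) \<le> 0"
    using optimal_barycentric_plan[OF I J p q p1 q1, of x y] by blast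
  define b where "b = barycentre J p y \<gamma>"
  \<comment> \<open>The displacements from the barycentres at the optimal plan become the slopes of
    both dual functions.\<close>
  define u where "u i = x i - b i" for i
  have \<gamma>0: "0 \<le> \<gamma> z" for z using \<gamma> unfolding transport_plans_def by blast
  have rows: "(\<Sum>j\<in>J. \<gamma> (i, j)) = p i" if "i \<in> I" for i
    using \<gamma> that by (simp add: transport_plans_def)
  have cols: "(\<Sum>i\<in>I. \<gamma> (i, j)) = q j" if "j \<in> J" for j
    using \<gamma> that by (simp add: transport_plans_def)
  have bary: "p i *\<^sub>R b i = (\<Sum>j\<in>J. \<gamma> (i, j) *\<^sub>R y j)" if "i \<in> I" for i
    using p[OF that] by (simp add: b_def barycentre_def)
  have ex: "\<exists>j\<in>J. 0 < \<gamma> (i, j)" if "i \<in> I" for i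
  proof (rule ccontr)
    assume "\<not> (\<exists>j\<in>J. 0 < \<gamma> (i, j))"
    then have "(\<Sum>j\<in>J. \<gamma> (i, j)) \<le> 0" by (intro sum_nonpos) (auto simp: not_less)
    with rows[OF that] p[OF that] show False by simp
  qed
  obtain c where c: "\<And>i j k. i \<in> I \<Longrightarrow> j \<in> J \<Longrightarrow> k \<in> I \<Longrightarrow> 0 < \<gamma> (i, j) \<Longrightarrow>
      u k \<bullet> y j - c k \<le> u i \<bullet> y j - c i"
    using transport_potential[OF I J ex, where a="\<lambda>(i, j). u i \<bullet> y j"] opt
    by (auto simp: u_def b_def)
  define \<phi> where "\<phi> z = (MAX i\<in>I. u i \<bullet> z - c i)" for z
  define h where "h z = (MAX i\<in>I. u i \<bullet> z - (c i + (norm (u i))\<^sup>2 / 2))" for z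
  have h_le: "h z - \<phi> z' \<le> (norm (z - z'))\<^sup>2 / 2" for z z'
  proof -
    have "h z \<le> \<phi> z' + (norm (z - z'))\<^sup>2 / 2"
      unfolding h_def
    proof (rule Max.boundedI)
      fix a assume "a \<in> (\<lambda>i. u i \<bullet> z - (c i + (norm (u i))\<^sup>2 / 2)) ` I"
      then obtain i where i: "i \<in> I" and a: "a = u i \<bullet> z - (c i + (norm (u i))\<^sup>2 / 2)" by blast
      have "0 \<le> (norm (z - z' - u i))\<^sup>2" by simp
      also have "\<dots> = (norm (z - z'))\<^sup>2 - 2 * (u i \<bullet> (z - z')) + (norm (u i))\<^sup>2"
        by (simp add: power2_norm_eq_inner inner_diff_left inner_diff_right inner_commute)
      finally have "a \<le> (u i \<bullet> z' - c i) + (norm (z - z'))\<^sup>2 / 2"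
        by (simp add: a inner_diff_right)
      moreover have "u i \<bullet> z' - c i \<le> \<phi> z'"
        unfolding \<phi>_def using I i by (intro Max_ge) auto
      ultimately show "a \<le> \<phi> z' + (norm (z - z'))\<^sup>2 / 2" by simp
    qed (use I I_ne in auto)
    then show ?thesis by simp
  qed
  \<comment> \<open>Where \<gamma> is positive, slackness says that row \<open>i\<close> attains the
    maximum defining \<phi>; elsewhere the factor \<gamma> is 0.\<close>
  have \<phi>_y: "\<gamma> (i, j) * \<phi> (y j) = \<gamma> (i, j) * (u i \<bullet> y j - c i)" if "i \<in> I" "j \<in> J" for i j
  proof (cases "\<gamma> (i, j) = 0")
    case False
    with \<gamma>0[of "(i, j)"] have "0 < \<gamma> (i, j)" by simp
    then have "\<phi> (y j) = u i \<bullet> y j - c i"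
      unfolding \<phi>_def using I that c by (intro Max_eqI) auto
    then show ?thesis by simp
  qed simp
  have "(\<Sum>j\<in>J. q j * \<phi> (y j)) = (\<Sum>j\<in>J. \<Sum>i\<in>I. \<gamma> (i, j) * \<phi> (y j))"
    by (intro sum.cong refl) (simp add: sum_distrib_right flip: cols)
  also have "\<dots> = (\<Sum>i\<in>I. \<Sum>j\<in>J. \<gamma> (i, j) * (u i \<bullet> y j - c i))"
    by (subst sum.swap) (intro sum.cong refl \<phi>_y)
  also have "\<dots> = (\<Sum>i\<in>I. p i * (u i \<bullet> b i - c i))"
  proof (rule sum.cong[OF refl])
    fix i assume i: "i \<in> I"
    have "(\<Sum>j\<in>J. \<gamma> (i, j) * (u i \<bullet> y j - c i)) = u i \<bullet> (\<Sum>j\<in>J. \<gamma> (i, j) *\<^sub>R y j) - (\<Sum>j\<in>J. \<gamma> (i, j)) * c i"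
      by (simp add: inner_sum_right right_diff_distrib sum_subtractf sum_distrib_right)
    then show "(\<Sum>j\<in>J. \<gamma> (i, j) * (u i \<bullet> y j - c i)) = p i * (u i \<bullet> b i - c i)"
      using rows[OF i] by (simp add: right_diff_distrib flip: bary[OF i])
  qed
  finally have \<phi>_sum: "(\<Sum>j\<in>J. q j * \<phi> (y j)) = (\<Sum>i\<in>I. p i * (u i \<bullet> b i - c i))" .
  have "(\<Sum>i\<in>I. p i * (norm (u i))\<^sup>2) / 2 + (\<Sum>j\<in>J. q j * \<phi> (y j))
      = (\<Sum>i\<in>I. p i * ((norm (u i))\<^sup>2 / 2 + (u i \<bullet> b i - c i)))"
    unfolding \<phi>_sum by (simp add: sum_divide_distrib sum.distrib distrib_left)
  also have "\<dots> \<le> (\<Sum>i\<in>I. p i * h (x i))"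
  proof (intro sum_mono mult_left_mono)
    fix i assume i: "i \<in> I"
    \<comment> \<open>Since u i = x i - b i, the i-th affine piece of \<open>h\<close> alone reaches
      the required value at x i.\<close>
    have "u i \<bullet> x i = u i \<bullet> b i + (norm (u i))\<^sup>2"
      by (simp add: u_def power2_norm_eq_inner inner_diff_right)
    then have "(norm (u i))\<^sup>2 / 2 + (u i \<bullet> b i - c i) = u i \<bullet> x i - (c i + (norm (u i))\<^sup>2 / 2)"
      by (simp add: field_simps)
    also have "\<dots> \<le> h (x i)"
      unfolding h_def using I i by (intro Max_ge) auto
    finally show "(norm (u i))\<^sup>2 / 2 + (u i \<bullet> b i - c i) \<le> h (x i)" .
  qed (use p in \<open>auto simp: less_imp_le\<close>)
  finally have main: "(\<Sum>i\<in>I. p i * (norm (u i))\<^sup>2) / 2 \<le> (\<Sum>i\<in>I. p i * h (x i)) - (\<Sum>j\<in>J. q j * \<phi> (y j))"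
    by simp
  have "convex_on UNIV h" unfolding h_def by (rule convex_on_Max_affine[OF I I_ne])
  moreover have "integrable M h" if M: "M \<in> P2" for M :: "'a measure"
  proof -
    interpret prob_space M using M by (rule P2_D)
    show ?thesis
      unfolding h_def
      by (rule integrable_Max_affine[OF I I_ne]) (rule sq_integrable_integrable[OF P2_D(4)[OF M]])
  qed
  ultimately show ?thesis
    using that[OF \<gamma>, of h \<phi>] h_le main by (simp add: u_def b_def)
qed

text \<open>Jensen in each row with the weights \<gamma> (i, j) / p i, then summation by columns. In
  other words, the law of the barycentres lies below the law of \<open>y\<close> in convex
  order.\<close>

lemma transport_plans_jensen:
  fixes y :: "'j \<Rightarrow> 'a::euclidean_space"
  assumes \<gamma>: "\<gamma> \<in> transport_plans I J p q" and J: "finite J" and p: "\<And>i. i \<in> I \<Longrightarrow> 0 < p i"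
    and g: "convex_on UNIV g"
  shows "(\<Sum>i\<in>I. p i * g (barycentre J p y \<gamma> i)) \<le> (\<Sum>j\<in>J. q j * g (y j))"
proof -
  have \<gamma>0: "0 \<le> \<gamma> z" for z using \<gamma> unfolding transport_plans_def by blast
  have rows: "(\<Sum>j\<in>J. \<gamma> (i, j)) = p i" if "i \<in> I" for i
    using \<gamma> that by (simp add: transport_plans_def)
  have cols: "(\<Sum>i\<in>I. \<gamma> (i, j)) = q j" if "j \<in> J" for j
    using \<gamma> that by (simp add: transport_plans_def)
  have "p i * g (barycentre J p y \<gamma> i) \<le> (\<Sum>j\<in>J. \<gamma> (i, j) * g (y j))" if i: "i \<in> I" for i
  proof -
    have J_ne: "J \<noteq> {}" using rows[OF i] p[OF i] by auto
    have "barycentre J p y \<gamma> i = (\<Sum>j\<in>J. (\<gamma> (i, j) / p i) *\<^sub>R y j)"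
      by (simp add: barycentre_def scaleR_sum_right)
    moreover have "g (\<Sum>j\<in>J. (\<gamma> (i, j) / p i) *\<^sub>R y j) \<le> (\<Sum>j\<in>J. (\<gamma> (i, j) / p i) * g (y j))"
    proof (rule convex_on_sum[OF J J_ne g])
      show "(\<Sum>j\<in>J. \<gamma> (i, j) / p i) = 1"
        using rows[OF i] p[OF i] by (simp flip: sum_divide_distrib)
    qed (use \<gamma>0 p[OF i] in auto)
    ultimately have "p i * g (barycentre J p y \<gamma> i) \<le> p i * (\<Sum>j\<in>J. (\<gamma> (i, j) / p i) * g (y j))"
      using p[OF i] by (intro mult_left_mono) auto
    also have "\<dots> = (\<Sum>j\<in>J. \<gamma> (i, j) * g (y j))"
      using p[OF i] by (simp add: sum_distrib_left)
    finally show ?thesis .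
  qed
  then have "(\<Sum>i\<in>I. p i * g (barycentre J p y \<gamma> i)) \<le> (\<Sum>i\<in>I. \<Sum>j\<in>J. \<gamma> (i, j) * g (y j))"
    by (rule sum_mono)
  also have "\<dots> = (\<Sum>j\<in>J. (\<Sum>i\<in>I. \<gamma> (i, j)) * g (y j))"
    by (subst sum.swap) (simp add: sum_distrib_right)
  also have "\<dots> = (\<Sum>j\<in>J. q j * g (y j))"
    using cols by (intro sum.cong) auto
  finally show ?thesis .
qed

subsection \<open>Distance to the set of laws below a perturbed measure\<close>

text \<open>Only \<mu> and \<nu>' are discretized, through cell means, whose laws lie below them in
  convex order; \<nu> stays as it is and enters through the dual function \<open>h\<close>. The
  three errors e are those of the cells of \<mu>, of the cells of \<nu>' and of the near-optimal
  coupling of \<nu> and \<nu>'.\<close>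

lemma projection_map_dist_le:
  assumes \<mu>: "\<mu> \<in> P2" and \<nu>: "\<nu> \<in> P2" and \<nu>': "\<nu>' \<in> P2" and cx: "\<mu> \<le>\<^sub>c\<^sub>x \<nu>"
    and T: "is_projection_map \<mu> \<nu>' T"
  shows "L2_norm \<mu> (\<lambda>x. x - T x) \<le> W2 \<nu> \<nu>'"
proof -
  interpret \<mu>: prob_space \<mu> using \<mu> by (rule P2_D)
  interpret \<nu>': prob_space \<nu>' using \<nu>' by (rule P2_D)
  have "L2_norm \<mu> (\<lambda>x. x - T x) \<le> W2 \<nu> \<nu>' + 3 * e" if e: "e > 0" for e
  proof -
    obtain s where s: "simple_function \<mu> s" "L2_norm \<mu> (\<lambda>x. x - s x) < e"
      using simple_function_L2_dense[OF P2_D(4)[OF \<mu>] e] by auto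
    obtain t where t: "simple_function \<nu>' t" "L2_norm \<nu>' (\<lambda>x. x - t x) < e"
      using simple_function_L2_dense[OF P2_D(4)[OF \<nu>'] e] by auto
    have i\<mu>: "integrable \<mu> (\<lambda>x. x)" and i\<nu>': "integrable \<nu>' (\<lambda>x. x)"
      using \<mu> \<nu>' by (auto intro: \<mu>.sq_integrable_integrable \<nu>'.sq_integrable_integrable P2_D)
    define p where "p v = measure \<mu> (s -` {v} \<inter> space \<mu>)" for v
    define q where "q v = measure \<nu>' (t -` {v} \<inter> space \<nu>')" for v
    \<comment> \<open>Cells of measure zero are dropped, since barycentres divide by
      \<open>p i\<close>.\<close>
    define I where "I = {v \<in> s ` space \<mu>. 0 < p v}"
    define J where "J = t ` space \<nu>'"
    define x where "x = cell_mean \<mu> s (\<lambda>x. x)"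
    define y where "y = cell_mean \<nu>' t (\<lambda>x. x)"
    have fI: "finite I" and fJ: "finite J"
      using simple_functionD(1)[OF s(1)] simple_functionD(1)[OF t(1)] by (auto simp: I_def J_def)
    have int_s: "(\<integral>z. f (s z) \<partial>\<mu>) = (\<Sum>i\<in>I. p i * f i)" for f :: "'a \<Rightarrow> real"
    proof -
      have "(\<integral>z. f (s z) \<partial>\<mu>) = (\<Sum>i\<in>s ` space \<mu>. p i * f i)"
        unfolding \<mu>.integral_simple_compose(2)[OF s(1)] by (simp add: p_def)
      also have "\<dots> = (\<Sum>i\<in>I. p i * f i)"
        using simple_functionD(1)[OF s(1)]
        by (intro sum.mono_neutral_right) (auto simp: I_def p_def not_less measure_le_0_iff)
      finally show ?thesis .
    qed
    have int_t: "(\<integral>z. f (t z) \<partial>\<nu>') = (\<Sum>j\<in>J. q j * f j)" for f :: "'a \<Rightarrow> real"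
      unfolding \<nu>'.integral_simple_compose(2)[OF t(1)] by (simp add: q_def J_def)
    have p: "0 < p i" if "i \<in> I" for i using that by (simp add: I_def)
    have q: "0 \<le> q j" for j by (simp add: q_def)
    have p1: "sum p I = 1" using int_s[of "\<lambda>_. 1"] by (simp add: \<mu>.prob_space)
    have q1: "sum q J = 1" using int_t[of "\<lambda>_. 1"] by (simp add: \<nu>'.prob_space)
    obtain \<gamma> h \<phi> where \<gamma>: "\<gamma> \<in> transport_plans I J p q"
      and h: "convex_on UNIV h" "\<And>M :: 'a measure. M \<in> P2 \<Longrightarrow> integrable M h"
      and h\<phi>: "\<And>a b. h a - \<phi> b \<le> (norm (a - b))\<^sup>2 / 2"
      and dual: "(\<Sum>i\<in>I. p i * (norm (x i - barycentre J p y \<gamma> i))\<^sup>2) / 2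
        \<le> (\<Sum>i\<in>I. p i * h (x i)) - (\<Sum>j\<in>J. q j * \<phi> (y j))"
      using barycentric_duality[OF fI fJ p q p1 q1, of x y] by blast
    define b where "b = barycentre J p y \<gamma>"
    let ?B = "\<lambda>z. b (s z)"
    have Bs: "sq_integrable \<mu> ?B" by (rule \<mu>.sq_integrable_simple_compose[OF s(1)])
    have xs: "sq_integrable \<mu> (\<lambda>z. x (s z))" by (rule \<mu>.sq_integrable_simple_compose[OF s(1)])
    \<comment> \<open>The barycentres provide a competitor for the projection: their law lies below
      that of the cell means \<open>y\<close>, hence below \<nu>'.\<close>
    have "nonneg_convex_order (distr \<mu> borel ?B) \<nu>'"
      unfolding nonneg_convex_order_def
    proof (intro allI impI)
      fix g :: "'a \<Rightarrow> real" assume g: "convex_on UNIV g" "\<forall>x. 0 \<le> g x"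
      have [measurable]: "g \<in> borel_measurable borel" using g(1) by (rule convex_on_UNIV_borel)
      have [measurable]: "?B \<in> borel_measurable \<mu>" using Bs by (rule sq_integrable_measurable)
      have "(\<integral>\<^sup>+x. ennreal (g x) \<partial>distr \<mu> borel ?B) = (\<integral>\<^sup>+z. ennreal (g (b (s z))) \<partial>\<mu>)"
        by (simp add: nn_integral_distr)
      also have "\<dots> = ennreal (\<integral>z. g (b (s z)) \<partial>\<mu>)"
        using g(2) \<mu>.integral_simple_compose(1)[OF s(1), of "\<lambda>v. g (b v)"]
        by (intro nn_integral_eq_integral) auto
      also have "\<dots> \<le> ennreal (\<integral>z. g (y (t z)) \<partial>\<nu>')"
        unfolding int_s[of "\<lambda>v. g (b v)"] int_t[of "\<lambda>v. g (y v)"] unfolding b_def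
        by (intro ennreal_leI transport_plans_jensen[OF \<gamma> fJ p g(1)])
      also have "\<dots> = (\<integral>\<^sup>+z. ennreal (g (y (t z))) \<partial>\<nu>')"
        using g(2) \<nu>'.integral_simple_compose(1)[OF t(1), of "\<lambda>v. g (y v)"]
        by (intro nn_integral_eq_integral[symmetric]) auto
      also have "\<dots> \<le> (\<integral>\<^sup>+z. ennreal (g z) \<partial>\<nu>')"
        unfolding y_def using g(2) by (intro \<nu>'.cell_mean_jensen_nn[OF t(1) i\<nu>' g(1)]) auto
      finally show "(\<integral>\<^sup>+x. ennreal (g x) \<partial>distr \<mu> borel ?B) \<le> (\<integral>\<^sup>+z. ennreal (g z) \<partial>\<nu>')" .
    qed
    then have "distr \<mu> borel ?B \<le>\<^sub>c\<^sub>x \<nu>'"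
      using convex_order_iff_nonneg[OF \<mu>.distr_in_P2[OF Bs] \<nu>'] by simp
    then have "L2_norm \<mu> (\<lambda>x. x - T x) \<le> W2 \<mu> (distr \<mu> borel ?B)"
      by (intro is_projection_map_D(5)[OF T \<mu>] \<mu>.distr_in_P2 Bs)
    also have "\<dots> \<le> L2_norm \<mu> (\<lambda>z. z - ?B z)"
      using \<mu>.W2_distr_le[OF P2_D(4)[OF \<mu>] Bs] by (simp add: distr_P2_id[OF \<mu>])
    also have "\<dots> \<le> L2_norm \<mu> (\<lambda>z. z - x (s z)) + L2_norm \<mu> (\<lambda>z. x (s z) - ?B z)"
      by (intro L2_norm_triangle P2_D(4)[OF \<mu>] xs Bs)
    also have "L2_norm \<mu> (\<lambda>z. z - x (s z)) \<le> L2_norm \<mu> (\<lambda>z. z - s z)"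
      unfolding x_def by (rule \<mu>.cell_mean_approx[OF s(1) P2_D(4)[OF \<mu>]])
    also have "L2_norm \<mu> (\<lambda>z. x (s z) - ?B z) \<le> W2 \<nu> \<nu>' + 2 * e"
    proof -
      obtain \<pi> where \<pi>: "\<pi> \<in> couplings \<nu> \<nu>'" "L2_norm \<pi> (\<lambda>w. fst w - snd w) < W2 \<nu> \<nu>' + e"
        using W2_near_optimal[OF \<nu> \<nu>' e] .
      interpret \<pi>: prob_space \<pi> using \<pi>(1) by (rule couplings_D)
      note c = couplings_D[OF \<pi>(1)]
      note [measurable] = c(3,4)
      note sq = couplings_sq_integrable[OF \<pi>(1) \<nu> \<nu>']
      have tb: "simple_function borel t" by (rule simple_function_P2_borel[OF \<nu>' t(1)])
      have t\<pi>: "simple_function \<pi> (\<lambda>w. t (snd w))"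
        by (rule simple_function_comp[OF _ tb]) simp
      have [measurable]: "h \<in> borel_measurable borel" "t \<in> borel_measurable borel"
          "(\<lambda>v. y (t v)) \<in> borel_measurable borel" "(\<lambda>v. \<phi> (y (t v))) \<in> borel_measurable borel"
        using h(1) tb simple_function_compose1[OF tb, of y] simple_function_compose1[OF tb, of "\<lambda>v. \<phi> (y v)"]
        by (auto intro: convex_on_UNIV_borel borel_measurable_simple_function)
      have ih: "integrable \<pi> (\<lambda>w. h (fst w))"
        using h(2)[OF \<nu>] unfolding c(5)[symmetric] by (simp add: integrable_distr_eq)
      have i\<phi>: "integrable \<pi> (\<lambda>w. \<phi> (y (t (snd w))))"
        by (rule \<pi>.integral_simple_compose(1)[OF t\<pi>])
      have yt: "sq_integrable \<pi> (\<lambda>w. y (t (snd w)))"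
        by (rule \<pi>.sq_integrable_simple_compose[OF t\<pi>])
      let ?R = "L2_norm \<pi> (\<lambda>w. fst w - y (t (snd w)))"
      have "(L2_norm \<mu> (\<lambda>z. x (s z) - ?B z))\<^sup>2 / 2
          = (\<Sum>i\<in>I. p i * (norm (x i - barycentre J p y \<gamma> i))\<^sup>2) / 2"
        unfolding L2_norm_power2 int_s[of "\<lambda>v. (norm (x v - b v))\<^sup>2"] by (simp add: b_def)
      also have "\<dots> \<le> (\<integral>z. h (x (s z)) \<partial>\<mu>) - (\<integral>z. \<phi> (y (t z)) \<partial>\<nu>')"
        using dual unfolding int_s[of "\<lambda>v. h (x v)"] int_t[of "\<lambda>v. \<phi> (y v)"] .
      \<comment> \<open>Convexity of \<open>h\<close> is used twice, by Jensen from the cell means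
        to \<mu> and by the order from \<mu> to \<nu>. For \<phi>, which enters with a minus sign,
        Jensen would go the wrong way; it stays at the cell means of \<nu>', and the distance to
        them costs one e.\<close>
      also have "(\<integral>z. h (x (s z)) \<partial>\<mu>) \<le> (\<integral>z. h z \<partial>\<mu>)"
        unfolding x_def by (rule \<mu>.cell_mean_jensen[OF s(1) i\<mu> h(1) h(2)[OF \<mu>]])
      also have "(\<integral>z. h z \<partial>\<mu>) \<le> (\<integral>z. h z \<partial>\<nu>)"
        by (rule convex_order_integral_le[OF cx h(1) h(2)[OF \<mu>] h(2)[OF \<nu>]])
      also have "(\<integral>z. h z \<partial>\<nu>) - (\<integral>z. \<phi> (y (t z)) \<partial>\<nu>')
          = (\<integral>w. h (fst w) \<partial>\<pi>) - (\<integral>w. \<phi> (y (t (snd w))) \<partial>\<pi>)"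
        unfolding c(5,6)[symmetric] by (simp add: integral_distr)
      also have "\<dots> = (\<integral>w. h (fst w) - \<phi> (y (t (snd w))) \<partial>\<pi>)"
        using ih i\<phi> by simp
      also have "\<dots> \<le> (\<integral>w. (norm (fst w - y (t (snd w))))\<^sup>2 / 2 \<partial>\<pi>)"
        using sq_integrable_diff[OF sq(1) yt] ih i\<phi>
        by (intro integral_mono h\<phi>) (auto simp: sq_integrable_def)
      also have "\<dots> = ?R\<^sup>2 / 2" by (simp add: L2_norm_power2)
      finally have "(L2_norm \<mu> (\<lambda>z. x (s z) - ?B z))\<^sup>2 \<le> ?R\<^sup>2" by simp
      then have "L2_norm \<mu> (\<lambda>z. x (s z) - ?B z) \<le> ?R"
        by (rule power2_le_imp_le) (rule L2_norm_nonneg)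
      also have "?R \<le> L2_norm \<pi> (\<lambda>w. fst w - snd w) + L2_norm \<pi> (\<lambda>w. snd w - y (t (snd w)))"
        by (intro L2_norm_triangle sq yt)
      also have "L2_norm \<pi> (\<lambda>w. snd w - y (t (snd w))) = L2_norm \<nu>' (\<lambda>z. z - y (t z))"
        unfolding c(6)[symmetric] by (simp add: L2_norm_distr)
      also have "\<dots> \<le> L2_norm \<nu>' (\<lambda>z. z - t z)"
        unfolding y_def by (rule \<nu>'.cell_mean_approx[OF t(1) P2_D(4)[OF \<nu>']])
      finally show ?thesis using t(2) \<pi>(2) by simp
    qed
    finally show ?thesis using s(2) by simp
  qed
  from this[of "_ / 3"] have "L2_norm \<mu> (\<lambda>x. x - T x) \<le> W2 \<nu> \<nu>' + e" if "e > 0" for e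
    using that by fastforce
  then show ?thesis by (rule field_le_epsilon)
qed

section \<open>Combination of the two estimates by the triangle inequality\<close>

theorem corollary2p4:
  fixes \<mu> \<mu>' \<nu> \<nu>' :: "(real ^ 'd) measure"
  assumes "\<mu> \<in> P2" and "\<mu>' \<in> P2" and "\<nu> \<in> P2" and "\<nu>' \<in> P2"
    and "\<mu> \<le>\<^sub>c\<^sub>x \<nu>"
  shows "W2 \<mu> (I2 \<mu>' \<nu>') \<le> centered_W2 \<mu> \<mu>' + W2 \<nu> \<nu>'"
proof -
  note P = assms(1-4)
  obtain T where T: "is_projection_map \<mu> \<nu>' T" using projection_map_exists[OF P(1,4)] .
  obtain T' where T': "is_projection_map \<mu>' \<nu>' T'" using projection_map_exists[OF P(2,4)] .
  define m where "m = (norm (mean \<mu> - mean \<mu>'))\<^sup>2"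
  have "W2 \<mu> (I2 \<mu>' \<nu>') \<le> sqrt ((W2 \<mu> \<mu>' + e)\<^sup>2 - m) + W2 \<nu> \<nu>'" if e: "e > 0" for e
  proof -
    obtain \<pi> where \<pi>: "\<pi> \<in> couplings \<mu> \<mu>'" "L2_norm \<pi> (\<lambda>w. fst w - snd w) < W2 \<mu> \<mu>' + e"
      using W2_near_optimal[OF P(1,2) e] .
    interpret \<pi>: prob_space \<pi> using \<pi>(1) by (rule couplings_D)
    note c = couplings_D[OF \<pi>(1)]
    note TD = is_projection_map_D[OF T P(1)] and TD' = is_projection_map_D[OF T' P(2)]
    note [measurable] = c(3,4) TD(2) TD'(2)
    note sq = couplings_sq_integrable[OF \<pi>(1) P(1,2)]
    have Y: "sq_integrable \<pi> (\<lambda>w. T (fst w))"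
      using TD(1) unfolding c(5)[symmetric] by (simp add: sq_integrable_distr)
    have Y': "sq_integrable \<pi> (\<lambda>w. T' (snd w))"
      using TD'(1) unfolding c(6)[symmetric] by (simp add: sq_integrable_distr)
    have "I2 \<mu>' \<nu>' = distr \<pi> borel (\<lambda>w. T' (snd w))"
      unfolding I2_eq_distr[OF T' P(2,4)] unfolding c(6)[symmetric] by (simp add: distr_distr comp_def)
    then have "W2 \<mu> (I2 \<mu>' \<nu>') \<le> L2_norm \<pi> (\<lambda>w. fst w - T' (snd w))"
      using \<pi>.W2_distr_le[OF sq(1) Y'] by (simp add: c)
    also have "\<dots> \<le> L2_norm \<pi> (\<lambda>w. fst w - T (fst w)) + L2_norm \<pi> (\<lambda>w. T (fst w) - T' (snd w))"
      by (intro L2_norm_triangle sq Y Y')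
    also have "L2_norm \<pi> (\<lambda>w. fst w - T (fst w)) = L2_norm \<mu> (\<lambda>x. x - T x)"
      unfolding c(5)[symmetric] by (simp add: L2_norm_distr)
    also have "\<dots> \<le> W2 \<nu> \<nu>'"
      by (rule projection_map_dist_le[OF P(1,3,4) assms(5) T])
    \<comment> \<open>The radicand dominates a square, so \<open>sqrt\<close> is not applied to a
      negative number.\<close>
    also have "L2_norm \<pi> (\<lambda>w. T (fst w) - T' (snd w)) \<le> sqrt ((W2 \<mu> \<mu>' + e)\<^sup>2 - m)"
    proof (rule real_le_rsqrt)
      have "(L2_norm \<pi> (\<lambda>w. fst w - snd w))\<^sup>2 \<le> (W2 \<mu> \<mu>' + e)\<^sup>2"
        using \<pi>(2) by (intro power_mono L2_norm_nonneg) simp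
      with projection_nonexpansive[OF \<pi>(1) P(1,2,4) T T']
      show "(L2_norm \<pi> (\<lambda>w. T (fst w) - T' (snd w)))\<^sup>2 \<le> (W2 \<mu> \<mu>' + e)\<^sup>2 - m"
        by (simp add: m_def)
    qed
    finally show ?thesis by simp
  qed
  then have "\<forall>\<^sub>F e in at_right 0. W2 \<mu> (I2 \<mu>' \<nu>') \<le> sqrt ((W2 \<mu> \<mu>' + e)\<^sup>2 - m) + W2 \<nu> \<nu>'"
    by (intro eventually_at_rightI[of 0 1]) auto
  \<comment> \<open>Continuity of \<open>sqrt\<close> lets e tend to 0 inside the root.\<close>
  moreover have "((\<lambda>e. sqrt ((W2 \<mu> \<mu>' + e)\<^sup>2 - m) + W2 \<nu> \<nu>')
      \<longlongrightarrow> sqrt ((W2 \<mu> \<mu>' + 0)\<^sup>2 - m) + W2 \<nu> \<nu>') (at_right 0)"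
    by (intro tendsto_intros)
  ultimately have "W2 \<mu> (I2 \<mu>' \<nu>') \<le> sqrt ((W2 \<mu> \<mu>' + 0)\<^sup>2 - m) + W2 \<nu> \<nu>'"
    by (intro tendsto_lowerbound) auto
  then show ?thesis by (simp add: centered_W2_def m_def)
qed

end
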